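(* Let $1\le p<\infty$ and let $\mathcal M\subset\mathbf R^d$ be an open set such that: (a) there exist $r_0>0$ and $\kappa_0>0$ with $\dfrac{|\mathcal M\cap B_{r_0}(x)|}{|B_{r_0}|}\ge\kappa_0$ for all $x\in\mathcal M$; (b) there exist $r_1,m>0$ and $k,\overline N\in\mathbf N$, $k\ge r_0+m$, such that for every $x\in\mathbf R^d$ the set $\mathcal M\cap\square^m_x$ is non-empty and any two points $\eta',\eta''\in\mathcal M\cap\square^m_x$ are joined by a discrete path $\{\eta_0=\eta',\eta_1,\dots,\eta_N,\eta_{N+1}=\eta''\}\subset\mathcal M\cap\square^k_x$ with $N\le\overline N$ and $|\eta_{j+1}-\eta_j|\le r_1$ for $j=0,\dots,N$. Then there exists a continuous linear operator $\widetilde{\,\cdot\,}:L^p(\mathcal M)\to L^p(\mathbf R^d)$ such that for all $r\ge2r_0+r_1$ and all $u\in L^p(\mathcal M)$: $$\widetilde u=u\quad\text{a.e. in }\mathcal M,$$ $$\int_{\mathbf R^d}|\widetilde u|^p\,dx\le c_1\int_{\mathcal M}|u|^p\,dx,$$ $$\int_{D_{m+r_0}}|\widetilde u(x)-\widetilde u(y)|^p\,dx\,dy\le c_2\int_{\mathcal M^2\cap D_r}|u(x)-u(y)|^p\,dx\,dy,$$ where $c_1=1+\sup_{x}\dfrac{|\square_x^{m+r_0}\setminus\mathcal M|}{|\mathcal M\cap\square_x^{m+r_0}|}$ and $c_2=c_2(c_1,k,\overline N,m,r)$.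
   Context: $B_r(x)$ is the open ball of radius $r$ centred at $x$, $B_r=B_r(0)$; $\square^m_x=[x-m,x+m]^d$ is the closed cube centred at $x$ with half-side $m$ (that is $x+[-m,m]^d$); $|A|$ is Lebesgue measure; $D_r=\{(x,y)\in\mathbf R^d\times\mathbf R^d:|x-y|<r\}$. The supremum in $c_1$ is over $x\in\mathbf R^d$.
   Formalization: The constant c_2 is allowed to depend also on r_0 and κ_0 (with p and d fixed); with c_2 depending only on c_1, k, N̄, m, r the claim fails, e.g. when long intervals of M are linked by chains of tiny blobs. *)

theory Defs
  imports "HOL-Analysis.Analysis"
begin

definition cube :: "real ^ 'd \<Rightarrow> real \<Rightarrow> (real ^ 'd) set" where
  "cube x m = cbox (x - (\<chi> i. m)) (x + (\<chi> i. m))"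

definition diag_nbhd :: "real \<Rightarrow> ((real ^ 'd) \<times> (real ^ 'd)) set" where
  "diag_nbhd r = {(x, y). norm (x - y) < r}"

definition density_cond :: "(real ^ 'd) set \<Rightarrow> real \<Rightarrow> real \<Rightarrow> bool" where
  "density_cond M r0 \<kappa>0 \<longleftrightarrow> 0 < r0 \<and> 0 < \<kappa>0 \<and>
     (\<forall>x\<in>M. measure lebesgue (M \<inter> ball x r0) / measure lebesgue (ball (0 :: real ^ 'd) r0) \<ge> \<kappa>0)"

definition discrete_path ::
  "(real ^ 'd) set \<Rightarrow> real \<Rightarrow> nat \<Rightarrow> real ^ 'd \<Rightarrow> real ^ 'd \<Rightarrow> bool" where
  "discrete_path S r1 N a b \<longleftrightarrow> (\<exists>\<eta> :: nat \<Rightarrow> real ^ 'd.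
     \<eta> 0 = a \<and> \<eta> (N + 1) = b \<and> (\<forall>j\<le>N + 1. \<eta> j \<in> S) \<and>
     (\<forall>j\<le>N. norm (\<eta> (j + 1) - \<eta> j) \<le> r1))"

definition path_cond ::
  "(real ^ 'd) set \<Rightarrow> real \<Rightarrow> real \<Rightarrow> real \<Rightarrow> nat \<Rightarrow> nat \<Rightarrow> bool" where
  "path_cond M r0 r1 m k Nmax \<longleftrightarrow> 0 < r1 \<and> 0 < m \<and> real k \<ge> r0 + m \<and>
     (\<forall>x. M \<inter> cube x m \<noteq> {} \<and>
        (\<forall>a\<in>M \<inter> cube x m. \<forall>b\<in>M \<inter> cube x m.
           \<exists>N\<le>Nmax. discrete_path (M \<inter> cube x (real k)) r1 N a b))"

definition fill_ratio :: "(real ^ 'd) set \<Rightarrow> real \<Rightarrow> real ^ 'd \<Rightarrow> real" where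
  "fill_ratio M s x = measure lebesgue (cube x s - M) / measure lebesgue (M \<inter> cube x s)"

text \<open>The supremum is taken in the reals; the lemma \<open>fill_ratio_bdd\<close> below shows that, under the
  two geometric conditions, it is the supremum of a bounded family of quotients with positive
  denominators.\<close>

definition const_c1 :: "(real ^ 'd) set \<Rightarrow> real \<Rightarrow> real \<Rightarrow> real" where
  "const_c1 M m r0 = 1 + (SUP x. fill_ratio M (m + r0) x)"

text \<open>Elements of \<open>L\<^sup>p(\<mu>)\<close> are represented by functions, not by classes modulo null sets.  Operators
  on \<open>L\<^sup>p\<close> are therefore maps on representatives that send almost everywhere equal functions to almost
  everywhere equal functions, and linearity is required almost everywhere.\<close>

definition Lp_set :: "real \<Rightarrow> 'a measure \<Rightarrow> ('a \<Rightarrow> real) set" where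
  "Lp_set p \<mu> = {u \<in> borel_measurable \<mu>. integrable \<mu> (\<lambda>x. \<bar>u x\<bar> powr p)}"

definition Lp_norm :: "real \<Rightarrow> 'a measure \<Rightarrow> ('a \<Rightarrow> real) \<Rightarrow> real" where
  "Lp_norm p \<mu> u = (\<integral>x. \<bar>u x\<bar> powr p \<partial>\<mu>) powr (1 / p)"

definition continuous_linear_Lp ::
  "real \<Rightarrow> 'a measure \<Rightarrow> 'b measure \<Rightarrow> (('a \<Rightarrow> real) \<Rightarrow> ('b \<Rightarrow> real)) \<Rightarrow> bool" where
  "continuous_linear_Lp p \<mu> \<nu> T \<longleftrightarrow>
     (\<forall>u\<in>Lp_set p \<mu>. T u \<in> Lp_set p \<nu>) \<and>
     (\<forall>u\<in>Lp_set p \<mu>. \<forall>v\<in>Lp_set p \<mu>. (AE x in \<mu>. u x = v x) \<longrightarrow> (AE x in \<nu>. T u x = T v x)) \<and>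
     (\<forall>u\<in>Lp_set p \<mu>. \<forall>v\<in>Lp_set p \<mu>. AE x in \<nu>. T (\<lambda>y. u y + v y) x = T u x + T v x) \<and>
     (\<forall>c. \<forall>u\<in>Lp_set p \<mu>. AE x in \<nu>. T (\<lambda>y. c * u y) x = c * T u x) \<and>
     (\<forall>u\<in>Lp_set p \<mu>. \<forall>\<epsilon>>0. \<exists>\<delta>>0. \<forall>v\<in>Lp_set p \<mu>.
        Lp_norm p \<mu> (\<lambda>x. v x - u x) < \<delta> \<longrightarrow> Lp_norm p \<nu> (\<lambda>x. T v x - T u x) < \<epsilon>)"

lemma ball_subset_cube:
  fixes x y :: "real ^ 'd"
  assumes "y \<in> cube x m"
  shows "ball y r \<subseteq> cube x (m + r)"
proof
  fix z assume z: "z \<in> ball y r"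
  have "x $ i - (m + r) \<le> z $ i \<and> z $ i \<le> x $ i + (m + r)" for i
  proof -
    have "\<bar>z $ i - y $ i\<bar> < r"
      using z component_le_norm_cart[of "z - y" i] by (simp add: dist_norm norm_minus_commute)
    moreover have "x $ i - m \<le> y $ i" "y $ i \<le> x $ i + m"
      using assms by (auto simp: cube_def mem_box_cart)
    ultimately show ?thesis by linarith
  qed
  then show "z \<in> cube x (m + r)" by (auto simp: cube_def mem_box_cart)
qed

lemma fill_ratio_bdd:
  fixes M :: "(real ^ 'd) set"
  assumes "open M" "density_cond M r0 \<kappa>0" "path_cond M r0 r1 m k Nmax"
  shows "measure lebesgue (M \<inter> cube x (m + r0)) > 0"
    and "bdd_above (range (fill_ratio M (m + r0)))"
proof -
  define b where "b = \<kappa>0 * measure lebesgue (ball (0 :: real ^ 'd) r0)"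
  define C where "C = measure lebesgue (cube (0 :: real ^ 'd) (m + r0))"
  have r0: "r0 > 0" and k0: "\<kappa>0 > 0" using assms(2) by (auto simp: density_cond_def)
  have vb: "measure lebesgue (ball (0 :: real ^ 'd) r0) > 0"
    using content_ball_pos[OF r0] by simp
  have b: "b > 0" using k0 vb by (simp add: b_def)
  have cm: "cube z s \<in> lmeasurable" for z :: "real ^ 'd" and s
    by (simp add: cube_def)
  have Ms: "M \<in> sets lebesgue" using assms(1) by (simp add: borel_open)
  have Mm: "M \<inter> cube z s \<in> lmeasurable" "cube z s - M \<in> lmeasurable" for z s
    using fmeasurable_Int_fmeasurable[OF cm[of z s] Ms] fmeasurable_Diff[OF cm[of z s] Ms]
    by (simp_all add: Int_commute)
  have low: "measure lebesgue (M \<inter> cube z (m + r0)) \<ge> b" for z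
  proof -
    obtain y where y: "y \<in> M" "y \<in> cube z m" using assms(3) unfolding path_cond_def by blast
    have "b \<le> measure lebesgue (M \<inter> ball y r0)"
      using assms(2) y(1) unfolding density_cond_def b_def pos_le_divide_eq[OF vb] by blast
    also have "\<dots> \<le> measure lebesgue (M \<inter> cube z (m + r0))"
      using ball_subset_cube[OF y(2), of r0] Mm Ms
      by (intro measure_mono_fmeasurable) auto
    finally show ?thesis .
  qed
  then show "measure lebesgue (M \<inter> cube x (m + r0)) > 0" using b by (meson less_le_trans)
  have tr: "cube z (m + r0) = (+) z ` cube 0 (m + r0)" for z :: "real ^ 'd"
    unfolding cube_def using cbox_translation[of z "- (\<chi> i. m + r0)" "\<chi> i. m + r0"] by simp
  have up: "measure lebesgue (cube z (m + r0) - M) \<le> C" for z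
  proof -
    have "measure lebesgue (cube z (m + r0) - M) \<le> measure lebesgue (cube z (m + r0))"
      using Mm cm by (intro measure_mono_fmeasurable) auto
    also have "\<dots> = C" unfolding C_def tr[of z] by (rule measure_translation)
    finally show ?thesis .
  qed
  have "fill_ratio M (m + r0) z \<le> C / b" for z
    unfolding fill_ratio_def using low[of z] up[of z] b by (intro frac_le) (auto simp: C_def)
  then show "bdd_above (range (fill_ratio M (m + r0)))" by (auto intro!: bdd_aboveI)
qed

end

theory Submission
  imports Defs
begin

text \<open>Tile space by half-open cubes of half-side \<open>m + r0\<close> and let \<open>T u\<close> be \<open>u\<close> on \<open>M\<close> and, off \<open>M\<close>, the
  average of \<open>u\<close> over the part of \<open>M\<close> in the same cube.  By Jensen and Tonelli, replacing one argument
  \<open>T u x\<close> in an integral over the whole space by \<open>u \<xi>\<close>, \<open>\<xi> \<in> M\<close>, costs a factor \<open>c1\<close> and moves the point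
  by at most the diameter of a cube; doing this twice bounds the energy of \<open>T u\<close> at range \<open>m + r0\<close>
  by \<open>c1\<^sup>2\<close> times the energy of \<open>u\<close> on \<open>M\<close> at some larger range \<open>L\<close>.

  To return to the range \<open>r\<close>, compare \<open>u x\<close> with the averages of \<open>u\<close> over \<open>M \<inter> ball \<eta> r0\<close> along a chain
  of points \<open>\<eta>\<close> of \<open>M\<close> with hops at most \<open>r - 2 * r0\<close>: each hop is controlled by the energy at range
  \<open>r\<close>, and by pigeonhole the number of hops needed inside a ball is bounded in terms of \<open>r\<close>, \<open>r0\<close> and the
  radius.\<close>

subsection \<open>Jensen's inequality for averages\<close>

text \<open>Convexity of the power on the open half line puts the graph above its tangent at
  \<open>a\<close>. The point \<open>t = 0\<close> lies outside that domain and is checked directly: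
  there the claim reduces to \<open>(1 - p) * a powr p \<le> 0\<close>.\<close>

lemma powr_above_tangent:
  fixes p a t :: real
  assumes p: "1 \<le> p" and a: "0 < a" and t: "0 \<le> t"
  shows "a powr p + p * a powr (p - 1) * (t - a) \<le> t powr p"
proof (cases "t = 0")
  case True
  have "a powr (p - 1) * a = a powr p" using a by (simp add: powr_diff)
  then have "a powr p + p * a powr (p - 1) * (t - a) = (1 - p) * a powr p"
    using True by (simp add: left_diff_distrib mult.assoc)
  also have "\<dots> \<le> 0" using p by (simp add: mult_nonpos_nonneg)
  finally show ?thesis using True by simp
next
  case False
  have "p * a powr (p - 1) * (t - a) \<le> t powr p - a powr p"
  proof (rule convex_on_imp_above_tangent[where A = "{0<..}"])
    show "convex_on {0<..} (\<lambda>x::real. x powr p)"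
      using p by (rule powr_convex)
    show "((\<lambda>x. x powr p) has_real_derivative p * a powr (p - 1)) (at a within {0<..})"
      using a by (rule has_field_derivative_at_within[OF has_real_derivative_powr])
    show "a \<in> interior {0<..}" using a by (simp add: interior_open)
    show "t \<in> {0<..}" using t False by simp
  qed auto
  then show ?thesis by simp
qed

text \<open>Integrate the tangent inequality at the mean \<open>a\<close> of
  \<open>\<bar>f - c\<bar>\<close> over \<open>A\<close>. The right-hand side is extended real, so
  only \<open>f\<close> itself has to be integrable and its p-th power may have infinite
  integral.\<close>

lemma jensen_set_average:
  fixes f :: "'a \<Rightarrow> real" and c p :: real
  assumes p: "1 \<le> p" and A: "A \<in> sets N" and fin: "emeasure N A < \<infinity>" and pos: "measure N A > 0"
    and f: "set_integrable N A f"
  shows "ennreal (\<bar>(LINT x:A|N. f x) / measure N A - c\<bar> powr p)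
    \<le> (\<integral>\<^sup>+x\<in>A. ennreal (\<bar>f x - c\<bar> powr p) \<partial>N) / ennreal (measure N A)"
proof -
  define \<mu> where "\<mu> = measure N A"
  define g where "g x = \<bar>f x - c\<bar>" for x
  define I where "I = (\<integral>\<^sup>+x\<in>A. ennreal (g x powr p) \<partial>N)"
  define a where "a = (LINT x:A|N. g x) / \<mu>"
  have mu: "\<mu> > 0" using pos by (simp add: \<mu>_def)
  have cint: "set_integrable N A (\<lambda>x. d)" for d :: real
    using A fin unfolding set_integrable_def by (simp add: integrable_indicator_iff)
  have fc: "set_integrable N A (\<lambda>x. f x - c)" using f cint by (rule set_integral_diff)
  have gi: "set_integrable N A g" unfolding g_def using fc by (rule set_integrable_abs)
  have gm: "(\<lambda>x. indicator A x * g x) \<in> borel_measurable N"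
    using gi unfolding set_integrable_def by (auto dest: borel_measurable_integrable)
  have const: "(LINT x:A|N. d) = d * \<mu>" for d :: real
    using A fin unfolding set_lebesgue_integral_def \<mu>_def
    by (simp add: mult.commute sets.Int_space_eq2)
  have "(LINT x:A|N. f x) / \<mu> - c = (LINT x:A|N. f x - c) / \<mu>"
    using set_integral_diff(2)[OF f cint[of c]] const[of c] mu by (simp add: field_simps)
  moreover have "\<bar>LINT x:A|N. f x - c\<bar> \<le> (LINT x:A|N. g x)"
    using set_integral_norm_bound[OF fc] by (simp add: g_def)
  ultimately have le: "\<bar>(LINT x:A|N. f x) / \<mu> - c\<bar> \<le> a"
    using mu by (simp add: a_def divide_right_mono)
  have "ennreal (a powr p) \<le> I / ennreal \<mu>"
  \<comment> \<open>The excluded cases are immediate: \<open>a = 0\<close> makes the left side zero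
    and \<open>I = top\<close> makes the right side infinite. Otherwise real-valued integrals can be
    used.\<close>
  proof (cases "a > 0 \<and> I < top")
    case False
    then consider "\<not> a > 0" | "\<not> I < top" by blast
    then show ?thesis
    proof cases
      assume "\<not> a > 0"
      then have "a = 0" using le by linarith
      then show ?thesis by simp
    next
      assume "\<not> I < top"
      then have "I = top" using less_top by blast
      then show ?thesis using mu by (simp add: ennreal_top_divide)
    qed
  next
    case True
    then have a: "a > 0" and I: "I < top" by auto
    have eq: "ennreal (g x powr p) * indicator A x = ennreal (indicator A x * g x powr p)" for x
      by (simp add: indicator_def)
    have eq2: "(\<lambda>x. indicator A x * g x powr p) = (\<lambda>x. (indicator A x * g x) powr p)"
      using p by (auto simp: indicator_def)
    have gp: "integrable N (\<lambda>x. indicator A x * g x powr p)"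
    proof (rule integrableI_nonneg)
      show "(\<lambda>x. indicator A x * g x powr p) \<in> borel_measurable N"
        unfolding eq2 using gm by measurable
      show "(\<integral>\<^sup>+x. ennreal (indicator A x * g x powr p) \<partial>N) < \<infinity>"
        using I unfolding I_def eq by simp
    qed auto
    then have gp': "set_integrable N A (\<lambda>x. g x powr p)" by (simp add: set_integrable_def)
    have Ieq: "I = ennreal (LINT x:A|N. g x powr p)"
      unfolding I_def eq set_lebesgue_integral_def using nn_integral_eq_integral[OF gp] by simp
    have lin: "set_integrable N A (\<lambda>x. p * a powr (p - 1) * (g x - a))"
      using set_integral_diff(1)[OF gi cint[of a]] by (rule set_integrable_mult_right)
    \<comment> \<open>The linear term of the tangent integrates to zero because \<open>a\<close> is
      the mean of \<open>g\<close> over \<open>A\<close>.\<close>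
    have "(LINT x:A|N. a powr p + p * a powr (p - 1) * (g x - a)) \<le> (LINT x:A|N. g x powr p)"
      using powr_above_tangent[OF p a]
      by (intro set_integral_mono set_integral_add(1)[OF cint lin] gp') (simp add: g_def)
    moreover have "(LINT x:A|N. a powr p + p * a powr (p - 1) * (g x - a))
      = (LINT x:A|N. a powr p) + (LINT x:A|N. p * a powr (p - 1) * (g x - a))"
      by (rule set_integral_add(2)[OF cint lin])
    moreover have "(LINT x:A|N. p * a powr (p - 1) * (g x - a)) = p * a powr (p - 1) * (LINT x:A|N. g x - a)"
      by (rule set_integral_mult_right)
    moreover have "(LINT x:A|N. g x - a) = (LINT x:A|N. g x) - a * \<mu>"
      by (simp only: set_integral_diff(2)[OF gi cint] const)
    moreover have "(LINT x:A|N. g x) - a * \<mu> = 0" using mu by (simp add: a_def)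
    ultimately have *: "a powr p * \<mu> \<le> (LINT x:A|N. g x powr p)" by (simp only: const mult_zero_right add_0_right)
    then have "a powr p \<le> (LINT x:A|N. g x powr p) / \<mu>" using mu by (simp add: field_simps)
    moreover have "(LINT x:A|N. g x powr p) \<ge> 0"
      using mu by (intro order_trans[OF _ *]) simp
    ultimately show ?thesis unfolding Ieq using mu by (simp add: divide_ennreal)
  qed
  moreover have "ennreal (\<bar>(LINT x:A|N. f x) / \<mu> - c\<bar> powr p) \<le> ennreal (a powr p)"
    using le p by (intro ennreal_leI powr_mono2) auto
  ultimately show ?thesis unfolding I_def g_def \<mu>_def by (rule order_trans[rotated])
qed

subsection \<open>Chains with bounded hops\<close>

text \<open>A relation rather than a sequence of points: its reflexive transitive closure records
  that a chain inside \<open>S\<close> exists and forgets its length.\<close>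

definition hops :: "'a::metric_space set \<Rightarrow> real \<Rightarrow> ('a \<times> 'a) set" where
  "hops S r = {(x, y). x \<in> S \<and> y \<in> S \<and> dist x y \<le> r}"

lemma sym_rtrancl_hops: "sym ((hops S r)\<^sup>*)"
  by (rule sym_rtrancl) (auto simp: sym_def hops_def dist_commute)

lemma rtrancl_hops_mono: "S \<subseteq> S' \<Longrightarrow> (hops S r)\<^sup>* \<subseteq> (hops S' r)\<^sup>*"
  by (rule rtrancl_mono) (auto simp: hops_def)

text \<open>The bound does not depend on the length of the chain: a chain visiting finitely many cells may
  be replaced by a path without repetitions in the graph of cells.\<close>

lemma oscillation_along_hops:
  fixes f :: "'a::metric_space \<Rightarrow> real"
  assumes fin: "finite \<C>" and card: "card \<C> \<le> n" and cov: "S \<subseteq> \<Union>\<C>"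
    and diam: "\<And>C x y. C \<in> \<C> \<Longrightarrow> x \<in> C \<Longrightarrow> y \<in> C \<Longrightarrow> dist x y \<le> \<rho>" and r: "r \<le> \<rho>"
    and osc: "\<And>x y. x \<in> S \<Longrightarrow> y \<in> S \<Longrightarrow> dist x y \<le> \<rho> \<Longrightarrow> \<bar>f x - f y\<bar> \<le> e"
    and x: "x \<in> S" and y: "y \<in> S" and chain: "(x, y) \<in> (hops S r)\<^sup>*"
  shows "\<bar>f x - f y\<bar> \<le> real (2 * n\<^sup>2 + 1) * e"
proof -
  \<comment> \<open>The graph of cells: an edge joins two cells containing points of
    \<open>S\<close> at distance at most \<open>r\<close>. It has at most \<open>n\<^sup>2\<close>
    edges.\<close>
  define R where "R = {(A, B). A \<in> \<C> \<and> B \<in> \<C> \<and> (\<exists>\<xi>\<in>A \<inter> S. \<exists>\<zeta>\<in>B \<inter> S. dist \<xi> \<zeta> \<le> r)}"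
  have Rsub: "R \<subseteq> \<C> \<times> \<C>" by (auto simp: R_def)
  have finR: "finite R" using finite_subset[OF Rsub] fin by simp
  have "card R \<le> card \<C> * card \<C>"
    using card_mono[OF _ Rsub] fin by (simp add: card_cartesian_product)
  also have "\<dots> \<le> n\<^sup>2" using card by (simp add: power2_eq_square mult_mono)
  finally have cardR: "card R \<le> n\<^sup>2" .
  have ex: "\<exists>A\<in>\<C>. \<exists>B\<in>\<C>. x \<in> A \<and> y \<in> B \<and> (A, B) \<in> R\<^sup>*" using chain
  proof (induction rule: rtrancl_induct)
    case base
    then show ?case using x cov by blast
  next
    case (step y z)
    then obtain A B where AB: "A \<in> \<C>" "B \<in> \<C>" "x \<in> A" "y \<in> B" "(A, B) \<in> R\<^sup>*" by blast
    from step(2) have yz: "y \<in> S" "z \<in> S" "dist y z \<le> r" by (auto simp: hops_def)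
    obtain C where C: "C \<in> \<C>" "z \<in> C" using yz(2) cov by blast
    have "(B, C) \<in> R" unfolding R_def using AB C yz by blast
    then show ?case using AB C by (meson rtrancl.rtrancl_into_rtrancl)
  qed
  have e: "0 \<le> e"
  proof -
    obtain A where "A \<in> \<C>" "x \<in> A" using x cov by blast
    then show ?thesis using osc[OF x x] diam[of A x x] by simp
  qed
  \<comment> \<open>One comparison inside the first cell, then two for each edge: across the edge
    and inside the cell just entered. This gives \<open>2 * j + 1\<close>.\<close>
  have bound: "(A, B) \<in> R ^^ j \<Longrightarrow> A \<in> \<C> \<Longrightarrow> \<xi> \<in> A \<inter> S \<Longrightarrow> \<zeta> \<in> B \<inter> S \<Longrightarrow>
      \<bar>f \<xi> - f \<zeta>\<bar> \<le> real (2 * j + 1) * e" for A B \<xi> \<zeta> j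
  proof (induction j arbitrary: B \<zeta>)
    case 0
    then show ?case using osc[of \<xi> \<zeta>] diam[of A \<xi> \<zeta>] by auto
  next
    case (Suc j)
    then obtain C where C: "(A, C) \<in> R ^^ j" "(C, B) \<in> R" by auto
    then obtain \<xi>1 \<zeta>1 where 1: "\<xi>1 \<in> C \<inter> S" "\<zeta>1 \<in> B \<inter> S" "dist \<xi>1 \<zeta>1 \<le> r" "B \<in> \<C>"
      by (auto simp: R_def)
    have "\<bar>f \<xi> - f \<xi>1\<bar> \<le> real (2 * j + 1) * e" using Suc.IH[OF C(1)] Suc.prems 1 by auto
    moreover have "\<bar>f \<xi>1 - f \<zeta>1\<bar> \<le> e" using 1 r by (intro osc) auto
    moreover have "\<bar>f \<zeta>1 - f \<zeta>\<bar> \<le> e" using 1 Suc.prems diam[of B \<zeta>1 \<zeta>] by (intro osc) auto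
    ultimately have "\<bar>f \<xi> - f \<zeta>\<bar> \<le> real (2 * j + 1) * e + e + e" by linarith
    also have "\<dots> = real (2 * Suc j + 1) * e" by (simp add: distrib_right)
    finally show ?case .
  qed
  from ex obtain A B where AB: "A \<in> \<C>" "x \<in> A" "y \<in> B" "(A, B) \<in> R\<^sup>*" by blast
  \<comment> \<open>This is the pigeonhole step: in a finite relation, reachability is realised in
    at most \<open>card R\<close> steps.\<close>
  then obtain j where j: "j \<le> card R" "(A, B) \<in> R ^^ j"
    using rtrancl_finite_eq_relpow[OF finR] by auto
  have "\<bar>f x - f y\<bar> \<le> real (2 * j + 1) * e" using bound[OF j(2) AB(1)] AB x y by blast
  also have "\<dots> \<le> real (2 * n\<^sup>2 + 1) * e"
    using j(1) cardR e by (intro mult_right_mono of_nat_mono) auto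
  finally show ?thesis .
qed

section \<open>Uniform covering numbers and chains from the path condition\<close>

text \<open>One number \<open>n\<close> serves all centres \<open>x\<close>, so constants built from
  it do not depend on position. The \<open>itself\<close> argument fixes the space, which otherwise
  occurs only in a bound variable.\<close>

definition covering_bound :: "'a::euclidean_space itself \<Rightarrow> real \<Rightarrow> real \<Rightarrow> nat \<Rightarrow> bool" where
  "covering_bound _ R \<rho> n \<longleftrightarrow> (\<forall>x::'a. \<exists>\<C>. finite \<C> \<and> card \<C> \<le> n \<and> ball x R \<subseteq> \<Union>\<C> \<and>
     (\<forall>C\<in>\<C>. \<forall>y\<in>C. \<forall>z\<in>C. dist y z \<le> \<rho>))"

text \<open>Total boundedness of one closed ball gives finitely many balls of radius
  \<open>\<rho> / 2\<close>; translating them covers a ball about any other centre with the same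
  number of sets.\<close>

lemma covering_bound_exists:
  assumes "0 < \<rho>"
  shows "\<exists>n. covering_bound TYPE('a::euclidean_space) R \<rho> n"
proof -
  have "compact (cball (0::'a) R)" by simp
  then obtain K where K: "finite K" "cball (0::'a) R \<subseteq> (\<Union>k\<in>K. ball k (\<rho> / 2))"
    using assms unfolding compact_eq_totally_bounded by (meson half_gt_zero)
  have "\<exists>\<C>. finite \<C> \<and> card \<C> \<le> card K \<and> ball x R \<subseteq> \<Union>\<C> \<and>
     (\<forall>C\<in>\<C>. \<forall>y\<in>C. \<forall>z\<in>C. dist y z \<le> \<rho>)" for x :: 'a
  proof (intro exI conjI)
    let ?C = "(\<lambda>k. ball (x + k) (\<rho> / 2)) ` K"
    show "finite ?C" "card ?C \<le> card K" using K(1) by (auto intro: card_image_le)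
    show "ball x R \<subseteq> \<Union>?C"
    proof
      fix y assume "y \<in> ball x R"
      then have "y - x \<in> cball 0 R" by (simp add: dist_norm norm_minus_commute)
      then obtain k where "k \<in> K" "y - x \<in> ball k (\<rho> / 2)" using K(2) by blast
      then show "y \<in> \<Union>?C" by (auto simp: dist_norm algebra_simps)
    qed
    show "\<forall>C\<in>?C. \<forall>y\<in>C. \<forall>z\<in>C. dist y z \<le> \<rho>"
    proof clarify
      fix k y z assume "y \<in> ball (x + k) (\<rho> / 2)" "z \<in> ball (x + k) (\<rho> / 2)"
      then show "dist y z \<le> \<rho>" using dist_triangle3[of y z "x + k"] by simp
    qed
  qed
  then show ?thesis unfolding covering_bound_def by blast
qed

lemma dist_le_of_mem_cube:
  fixes x y :: "real ^ 'd"
  assumes "y \<in> cube x s"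
  shows "dist x y \<le> s * CARD('d)"
proof -
  have "dist x y = norm (y - x)" by (simp add: dist_norm norm_minus_commute)
  also have "\<dots> \<le> (\<Sum>i\<in>UNIV. \<bar>(y - x) $ i\<bar>)" by (rule norm_le_l1_cart)
  also have "\<dots> \<le> (\<Sum>i\<in>(UNIV::'d set). s)"
    using assms by (intro sum_mono) (auto simp: cube_def mem_box_cart abs_le_iff algebra_simps)
  finally show ?thesis by (simp add: mult.commute)
qed

lemma discrete_path_hops:
  assumes "discrete_path S r N a b"
  shows "(a, b) \<in> (hops S r)\<^sup>*"
proof -
  obtain \<eta> where \<eta>: "\<eta> 0 = a" "\<eta> (N + 1) = b" "\<And>j. j \<le> N + 1 \<Longrightarrow> \<eta> j \<in> S"
    "\<And>j. j \<le> N \<Longrightarrow> norm (\<eta> (j + 1) - \<eta> j) \<le> r"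
    using assms unfolding discrete_path_def by blast
  have "j \<le> N + 1 \<Longrightarrow> (a, \<eta> j) \<in> (hops S r)\<^sup>*" for j
  proof (induction j)
    case (Suc j)
    then have "(\<eta> j, \<eta> (Suc j)) \<in> hops S r"
      using \<eta>(3)[of j] \<eta>(3)[of "Suc j"] \<eta>(4)[of j] by (auto simp: hops_def dist_norm norm_minus_commute)
    then show ?case using Suc by (auto intro: rtrancl.rtrancl_into_rtrancl)
  qed (simp add: \<eta>)
  then show ?thesis using \<eta>(2) by blast
qed

text \<open>The hypothesis only connects points of a common small cube.  Since \<open>M\<close> is open, nearby cubes
  share a point of \<open>M\<close>, so the reachable component is locally constant in the centre of the cube.\<close>

lemma hops_of_path_cond:
  fixes M :: "(real ^ 'd) set"
  assumes M: "open M" and path: "path_cond M r0 r1 m k Nmax"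
    and x: "x \<in> M" and y: "y \<in> M" and xy: "dist x y < L"
    and R: "L + k * CARD('d) \<le> R"
  shows "(x, y) \<in> (hops (M \<inter> ball x R) r1)\<^sup>*"
proof -
  define H where "H = (hops (M \<inter> ball x R) r1)\<^sup>*"
  have m: "m > 0" using path by (simp add: path_cond_def)
  \<comment> \<open>For a centre \<open>w\<close> in \<open>ball x L\<close> the path supplied by
    the hypothesis stays in the cube of half-side \<open>k\<close> about \<open>w\<close>, hence in
    \<open>ball x R\<close>.\<close>
  have H: "(a, b) \<in> H" if "w \<in> ball x L" "a \<in> M \<inter> cube w m" "b \<in> M \<inter> cube w m" for a b w
  proof -
    have "\<exists>N\<le>Nmax. discrete_path (M \<inter> cube w (real k)) r1 N a b"
      using path that(2,3) unfolding path_cond_def by simp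
    then obtain N where "discrete_path (M \<inter> cube w (real k)) r1 N a b" by blast
    then have "(a, b) \<in> (hops (M \<inter> cube w (real k)) r1)\<^sup>*" by (rule discrete_path_hops)
    moreover have "cube w (real k) \<subseteq> ball x R"
    proof
      fix z assume "z \<in> cube w (real k)"
      then have "dist w z \<le> k * CARD('d)" using dist_le_of_mem_cube by fastforce
      then show "z \<in> ball x R" using that(1) R dist_triangle[of x z w] by auto
    qed
    then have "M \<inter> cube w (real k) \<subseteq> M \<inter> ball x R" by blast
    ultimately show ?thesis unfolding H_def using rtrancl_hops_mono by blast
  qed
  have L: "L > 0" using xy by (meson le_less_trans zero_le_dist)
  \<comment> \<open>All points of \<open>M\<close> in the two small cubes are mutually reachable.
    \<open>Q\<close> is symmetric and transitive because each small cube meets \<open>M\<close>;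
    connectedness of \<open>ball x L\<close> then carries it from \<open>x\<close> to
    \<open>y\<close>.\<close>
  define Q where "Q w w' \<longleftrightarrow> (\<forall>a\<in>M \<inter> cube w m. \<forall>b\<in>M \<inter> cube w' m. (a, b) \<in> H)" for w w'
  have ne: "M \<inter> cube w m \<noteq> {}" for w using path by (simp add: path_cond_def)
  have "Q x y"
  proof (rule connected_equivalence_relation[of "ball x L"])
    show "Q w' w" if "Q w w'" for w w'
      unfolding Q_def
    proof (intro ballI)
      fix a b assume "a \<in> M \<inter> cube w' m" "b \<in> M \<inter> cube w m"
      then have "(b, a) \<in> H" using that unfolding Q_def by blast
      then show "(a, b) \<in> H" unfolding H_def by (rule symD[OF sym_rtrancl_hops])
    qed
    show "Q w1 w3" if "Q w1 w2" "Q w2 w3" for w1 w2 w3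
      unfolding Q_def
    proof (intro ballI)
      fix a b assume ab: "a \<in> M \<inter> cube w1 m" "b \<in> M \<inter> cube w3 m"
      obtain z where "z \<in> M \<inter> cube w2 m" using ne by blast
      then have "(a, z) \<in> H" "(z, b) \<in> H" using that ab unfolding Q_def by blast+
      then show "(a, b) \<in> H" unfolding H_def by (rule rtrancl_trans)
    qed
    show "\<exists>T. openin (top_of_set (ball x L)) T \<and> w \<in> T \<and> (\<forall>v\<in>T. Q w v)" if w: "w \<in> ball x L" for w
    proof -
      \<comment> \<open>An open set that meets the closed cube also meets its interior. A point
        \<open>\<xi>\<close> of \<open>M\<close> chosen there remains in the cube when the centre
        moves within the neighbourhood \<open>T\<close>.\<close>
      have "box (w - (\<chi> i. m)) (w + (\<chi> i. m)) \<noteq> {}"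
        using m by (simp add: interval_ne_empty_cart)
      then have "M \<inter> box (w - (\<chi> i. m)) (w + (\<chi> i. m)) \<noteq> {}"
        using ne[of w] open_Int_closure_eq_empty[OF M, of "box (w - (\<chi> i. m)) (w + (\<chi> i. m))"]
        by (simp add: closure_box cube_def)
      then obtain \<xi> where \<xi>: "\<xi> \<in> M" "\<xi> \<in> box (w - (\<chi> i. m)) (w + (\<chi> i. m))" by blast
      define T where "T = ball x L \<inter> box (\<xi> - (\<chi> i. m)) (\<xi> + (\<chi> i. m))"
      have wT: "w \<in> T" using w \<xi>(2) unfolding T_def by (auto simp: mem_box_cart algebra_simps)
      have "Q w v" if v: "v \<in> T" for v
      proof -
        have "\<xi> \<in> cube w m" "\<xi> \<in> cube v m"
          using \<xi>(2) v unfolding T_def cube_def by (auto simp: mem_box_cart algebra_simps less_imp_le)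
        then have \<xi>': "\<xi> \<in> M \<inter> cube w m" "\<xi> \<in> M \<inter> cube v m" using \<xi>(1) by blast+
        have vL: "v \<in> ball x L" using v unfolding T_def by blast
        show ?thesis unfolding Q_def
        proof (intro ballI)
          fix a b assume ab: "a \<in> M \<inter> cube w m" "b \<in> M \<inter> cube v m"
          have "(a, \<xi>) \<in> H" using w ab(1) \<xi>'(1) by (rule H)
          moreover have "(\<xi>, b) \<in> H" using vL \<xi>'(2) ab(2) by (rule H)
          ultimately show "(a, b) \<in> H" unfolding H_def by (rule rtrancl_trans)
        qed
      qed
      moreover have "openin (top_of_set (ball x L)) T" unfolding T_def by (intro openin_open_Int open_box)
      ultimately show ?thesis using wT by blast
    qed
  qed (use xy L in auto)
  moreover have "x \<in> cube x m" "y \<in> cube y m" using m by (auto simp: cube_def mem_box_cart)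
  ultimately show ?thesis using x y unfolding Q_def H_def by blast
qed

subsection \<open>Nonlocal energies at different ranges\<close>

text \<open>Extended nonnegative values let Tonelli be applied without first knowing that the energy
  is finite.\<close>

definition nonlocal_density :: "real \<Rightarrow> 'a::metric_space set \<Rightarrow> real \<Rightarrow> ('a \<Rightarrow> real) \<Rightarrow> 'a \<Rightarrow> 'a \<Rightarrow> ennreal" where
  "nonlocal_density p M r v x y =
     (if x \<in> M \<and> y \<in> M \<and> dist x y < r then ennreal (\<bar>v x - v y\<bar> powr p) else 0)"

text \<open>An iterated integral, ready for estimates in one variable at a time;
  \<open>nn_integral_diag_nbhd\<close> identifies it with the integral over a neighbourhood of the
  diagonal.\<close>

definition nonlocal_energy :: "real \<Rightarrow> 'a::euclidean_space set \<Rightarrow> real \<Rightarrow> ('a \<Rightarrow> real) \<Rightarrow> ennreal" where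
  "nonlocal_energy p M r v = (\<integral>\<^sup>+x. \<integral>\<^sup>+y. nonlocal_density p M r v x y \<partial>lborel \<partial>lborel)"

lemma measurable_nonlocal_density [measurable]:
  fixes M :: "'a::euclidean_space set"
  assumes [measurable]: "M \<in> sets borel" "v \<in> borel_measurable borel"
    "f \<in> measurable N borel" "g \<in> measurable N borel"
  shows "(\<lambda>z. nonlocal_density p M r v (f z) (g z)) \<in> borel_measurable N"
  unfolding nonlocal_density_def by measurable

lemma emeasure_lborel_ball:
  "emeasure lborel (ball (x::'a::euclidean_space) r) = ennreal (measure lborel (ball (0::'a) r))"
proof -
  have "measure lborel (ball x r) = measure lborel (ball (0::'a) r)"
    by (cases "r > 0") (simp_all add: content_ball ball_empty)
  then show ?thesis
    using emeasure_bounded_finite[of "ball x r"] by (simp add: emeasure_eq_ennreal_measure less_top)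
qed

lemma nn_integral_dist_less:
  fixes x :: "'a::euclidean_space"
  shows "(\<integral>\<^sup>+y. (if dist x y < r then c else 0) \<partial>lborel) = c * ennreal (measure lborel (ball (0::'a) r))"
proof -
  have "(\<lambda>y. if dist x y < r then c else 0) = (\<lambda>y. c * indicator (ball x r) y)"
    by (auto simp: indicator_def)
  then show ?thesis using nn_integral_cmult_indicator[of "ball x r" lborel c] by (simp add: emeasure_lborel_ball)
qed

lemma powr_sum3_le:
  fixes a b c p :: real
  assumes p: "1 \<le> p" and "0 \<le> a" "0 \<le> b" "0 \<le> c"
  shows "(a + b + c) powr p \<le> 3 powr p * (a powr p + b powr p + c powr p)"
proof -
  define s where "s = max a (max b c)"
  have "(a + b + c) powr p \<le> (3 * s) powr p"
    using assms unfolding s_def by (intro powr_mono2) auto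
  also have "\<dots> = 3 powr p * s powr p" using assms by (simp add: powr_mult s_def)
  also have "s powr p \<le> a powr p + b powr p + c powr p"
    unfolding s_def max_def by auto
  finally show ?thesis by simp
qed

text \<open>The comparison goes through the averages of \<open>v\<close> over \<open>M \<inter> ball \<eta> r0\<close>.  Hops of length at most
  \<open>r - 2 * r0\<close> are admissible because the points of the two balls are then at distance less than \<open>r\<close>.\<close>

lemma nonlocal_difference_le:
  fixes M :: "'a::euclidean_space set" and v :: "'a \<Rightarrow> real" and p r :: real
  defines "g \<equiv> \<lambda>x. \<integral>\<^sup>+y. nonlocal_density p M r v x y \<partial>lborel"
  assumes p: "1 \<le> p" and M [measurable]: "M \<in> sets borel" and v [measurable]: "v \<in> borel_measurable borel"
    and vint: "\<And>x. set_integrable lborel (M \<inter> ball x r0) v"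
    and dens: "\<And>x. x \<in> M \<Longrightarrow> b \<le> measure lborel (M \<inter> ball x r0)" and b: "0 < b"
    and r0: "0 < r0" and r1: "0 < r1" and r: "2 * r0 + r1 \<le> r"
    and cov: "covering_bound TYPE('a) R (r - 2 * r0) n"
    and x: "x \<in> M" "x \<in> ball x R" and y: "y \<in> M" "y \<in> ball x R"
    and chain: "(x, y) \<in> (hops (M \<inter> ball x R) r1)\<^sup>*"
  shows "ennreal (\<bar>v x - v y\<bar> powr p) \<le> ennreal (3 powr p) *
    (g x / ennreal b + g y / ennreal b +
     ennreal (real (2 * n\<^sup>2 + 1) powr p / b\<^sup>2) * (\<integral>\<^sup>+\<xi>. (if dist x \<xi> < R + r0 then g \<xi> else 0) \<partial>lborel))"
proof -
  have g: "g x = (\<integral>\<^sup>+y. nonlocal_density p M r v x y \<partial>lborel)" for x by (simp add: g_def)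
  have gm [measurable]: "g \<in> borel_measurable borel"
    unfolding g using lborel.borel_measurable_nn_integral[of "nonlocal_density p M r v" borel] by simp
  define W where "W = (\<integral>\<^sup>+\<xi>. (if dist x \<xi> < R + r0 then g \<xi> else 0) \<partial>lborel)"
  define A where "A \<eta> = M \<inter> ball \<eta> r0" for \<eta>
  define a where "a \<eta> = (LINT \<xi>:A \<eta>|lborel. v \<xi>) / measure lborel (A \<eta>)" for \<eta>
  have A [measurable]: "A \<eta> \<in> sets borel" for \<eta> unfolding A_def by measurable
  have fin: "emeasure lborel (A \<eta>) < \<infinity>" for \<eta>
    using emeasure_bounded_finite[of "A \<eta>"] by (simp add: A_def bounded_Int)
  \<comment> \<open>Jensen divides by the measure of \<open>A \<eta>\<close>, and the density bound
    replaces that measure by the uniform constant \<open>b\<close>.\<close>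
  have jensen: "ennreal (\<bar>a \<eta> - c\<bar> powr p) \<le> B / ennreal b"
    if \<eta>: "\<eta> \<in> M" and B: "(\<integral>\<^sup>+\<xi>\<in>A \<eta>. ennreal (\<bar>v \<xi> - c\<bar> powr p) \<partial>lborel) \<le> B" for \<eta> c B
  proof -
    have m: "b \<le> measure lborel (A \<eta>)" using dens[OF \<eta>] by (simp add: A_def)
    have "ennreal (\<bar>a \<eta> - c\<bar> powr p)
        \<le> (\<integral>\<^sup>+\<xi>\<in>A \<eta>. ennreal (\<bar>v \<xi> - c\<bar> powr p) \<partial>lborel) / ennreal (measure lborel (A \<eta>))"
      unfolding a_def using m b vint[of \<eta>] fin[of \<eta>] by (intro jensen_set_average p) (auto simp: A_def)
    also have "\<dots> \<le> B / ennreal b"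
      unfolding divide_ennreal_def using B m b
      by (intro mult_mono) (simp_all add: inverse_ennreal ennreal_leI le_imp_inverse_le)
    finally show ?thesis .
  qed
  \<comment> \<open>A point of \<open>A \<eta>\<close> is closer than \<open>r0\<close> to
    \<open>\<eta>\<close>, so it is within range \<open>r\<close> of \<open>\<xi>\<close> and its
    contribution is already counted in \<open>g \<xi>\<close>.\<close>
  have near: "ennreal (\<bar>a \<eta> - v \<xi>\<bar> powr p) \<le> g \<xi> / ennreal b"
    if "\<eta> \<in> M" "\<xi> \<in> M" "dist \<eta> \<xi> < r - r0" for \<eta> \<xi>
  proof (rule jensen[OF that(1)])
    have "ennreal (\<bar>v \<zeta> - v \<xi>\<bar> powr p) * indicator (A \<eta>) \<zeta> \<le> nonlocal_density p M r v \<xi> \<zeta>" for \<zeta>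
    proof (cases "\<zeta> \<in> A \<eta>")
      case True
      then have "\<zeta> \<in> M" "dist \<xi> \<zeta> < r"
        using that(3) dist_triangle3[of \<xi> \<zeta> \<eta>] by (auto simp: A_def dist_commute)
      then show ?thesis using that(2) True by (simp add: nonlocal_density_def abs_minus_commute)
    qed simp
    then show "(\<integral>\<^sup>+\<zeta>\<in>A \<eta>. ennreal (\<bar>v \<zeta> - v \<xi>\<bar> powr p) \<partial>lborel) \<le> g \<xi>"
      unfolding g by (intro nn_integral_mono)
  qed
  \<comment> \<open>Two averagings cost two factors \<open>1 / b\<close>: Jensen over
    \<open>A \<eta>\<close> with the constant \<open>a \<eta>'\<close>, then \<open>near\<close> at
    each of its points. These points stay in \<open>ball x (R + r0)\<close>, so \<open>W\<close>
    controls all hops simultaneously.\<close>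
  have hop: "ennreal (\<bar>a \<eta> - a \<eta>'\<bar> powr p) \<le> W / ennreal b / ennreal b"
    if "\<eta> \<in> M \<inter> ball x R" "\<eta>' \<in> M \<inter> ball x R" "dist \<eta> \<eta>' \<le> r - 2 * r0" for \<eta> \<eta>'
  proof (rule jensen)
    show "\<eta> \<in> M" using that by simp
    have "ennreal (\<bar>v \<xi> - a \<eta>'\<bar> powr p) * indicator (A \<eta>) \<xi>
        \<le> (if dist x \<xi> < R + r0 then g \<xi> else 0) / ennreal b" for \<xi>
    proof (cases "\<xi> \<in> A \<eta>")
      case True
      then have "\<xi> \<in> M" "dist \<eta>' \<xi> < r - r0" "dist x \<xi> < R + r0"
        using that dist_triangle3[of \<eta>' \<xi> \<eta>] dist_triangle[of x \<xi> \<eta>] by (auto simp: A_def dist_commute)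
      then show ?thesis using near[of \<eta>' \<xi>] that(2) True by (simp add: abs_minus_commute)
    qed simp
    then have "(\<integral>\<^sup>+\<xi>\<in>A \<eta>. ennreal (\<bar>v \<xi> - a \<eta>'\<bar> powr p) \<partial>lborel)
        \<le> (\<integral>\<^sup>+\<xi>. (if dist x \<xi> < R + r0 then g \<xi> else 0) / ennreal b \<partial>lborel)"
      by (intro nn_integral_mono)
    also have "\<dots> = W / ennreal b" unfolding W_def by (rule nn_integral_divide) measurable
    finally show "(\<integral>\<^sup>+\<xi>\<in>A \<eta>. ennreal (\<bar>v \<xi> - a \<eta>'\<bar> powr p) \<partial>lborel) \<le> W / ennreal b" .
  qed
  define K where "K = real (2 * n\<^sup>2 + 1)"
  have K: "K > 0" unfolding K_def by linarith
  \<comment> \<open>If \<open>W\<close> is infinite, so is the right side. Otherwise the common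
    oscillation bound \<open>e\<close> is the p-th root of \<open>w / b\<^sup>2\<close>, and the
    chain multiplies it by \<open>K\<close>.\<close>
  have far: "ennreal (\<bar>a x - a y\<bar> powr p) \<le> ennreal (K powr p / b\<^sup>2) * W"
  proof (cases "W = top")
    case True
    then show ?thesis using K b by (simp add: ennreal_mult_top)
  next
    case False
    then obtain w where w: "W = ennreal w" "w \<ge> 0" by (cases W) auto
    define e where "e = (w / b\<^sup>2) powr (1 / p)"
    have ep: "e powr p = w / b\<^sup>2" unfolding e_def using p w b by (simp add: powr_powr)
    obtain \<C> where \<C>: "finite \<C>" "card \<C> \<le> n" "ball x R \<subseteq> \<Union>\<C>"
      "\<And>C y z. C \<in> \<C> \<Longrightarrow> y \<in> C \<Longrightarrow> z \<in> C \<Longrightarrow> dist y z \<le> r - 2 * r0"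
      using cov unfolding covering_bound_def by metis
    have "\<bar>a x - a y\<bar> \<le> K * e"
      unfolding K_def
    proof (rule oscillation_along_hops[OF \<C>(1,2) _ \<C>(4) _ _ _ _ chain])
      show "M \<inter> ball x R \<subseteq> \<Union>\<C>" using \<C>(3) by blast
      show "r1 \<le> r - 2 * r0" using r by simp
      show "x \<in> M \<inter> ball x R" "y \<in> M \<inter> ball x R" using x y by auto
      show "\<bar>a \<eta> - a \<eta>'\<bar> \<le> e"
        if "\<eta> \<in> M \<inter> ball x R" "\<eta>' \<in> M \<inter> ball x R" "dist \<eta> \<eta>' \<le> r - 2 * r0" for \<eta> \<eta>'
      proof -
        have "ennreal (\<bar>a \<eta> - a \<eta>'\<bar> powr p) \<le> ennreal (w / b / b)"
          using hop[OF that] w b by (simp add: divide_ennreal)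
        then have le: "\<bar>a \<eta> - a \<eta>'\<bar> powr p \<le> w / b\<^sup>2"
          using w b by (simp add: ennreal_le_iff power2_eq_square)
        have "\<bar>a \<eta> - a \<eta>'\<bar> = (\<bar>a \<eta> - a \<eta>'\<bar> powr p) powr (1 / p)"
          using p by (simp add: powr_powr)
        also have "\<dots> \<le> e" unfolding e_def using p le by (intro powr_mono2) auto
        finally show ?thesis .
      qed
    qed
    then have "\<bar>a x - a y\<bar> powr p \<le> (K * e) powr p" using p by (intro powr_mono2) auto
    also have "\<dots> = K powr p / b\<^sup>2 * w" using K by (simp add: powr_mult ep e_def[symmetric])
    finally show ?thesis using w K by (simp add: ennreal_mult'[symmetric] ennreal_leI)
  qed
  \<comment> \<open>The endpoints are compared with their own averages by \<open>near\<close>, and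
    the two averages with each other by \<open>far\<close>.\<close>
  have "\<bar>v x - v y\<bar> \<le> \<bar>a x - v x\<bar> + \<bar>a y - v y\<bar> + \<bar>a x - a y\<bar>" by linarith
  then have "\<bar>v x - v y\<bar> powr p \<le> (\<bar>a x - v x\<bar> + \<bar>a y - v y\<bar> + \<bar>a x - a y\<bar>) powr p"
    using p by (intro powr_mono2) auto
  also have "\<dots> \<le> 3 powr p * (\<bar>a x - v x\<bar> powr p + \<bar>a y - v y\<bar> powr p + \<bar>a x - a y\<bar> powr p)"
    using p by (intro powr_sum3_le) auto
  finally have "ennreal (\<bar>v x - v y\<bar> powr p) \<le> ennreal (3 powr p) *
     (ennreal (\<bar>a x - v x\<bar> powr p) + ennreal (\<bar>a y - v y\<bar> powr p) + ennreal (\<bar>a x - a y\<bar> powr p))"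
    by (simp add: ennreal_plus[symmetric] ennreal_mult'[symmetric] ennreal_leI del: ennreal_plus)
  also have "\<dots> \<le> ennreal (3 powr p) * (g x / ennreal b + g y / ennreal b + ennreal (K powr p / b\<^sup>2) * W)"
    using x y r0 r1 r by (intro mult_left_mono add_mono near far) auto
  finally show ?thesis unfolding K_def W_def .
qed

text \<open>Integrate the pointwise comparison over pairs at distance below \<open>L\<close>. The
  terms \<open>g x\<close> and \<open>g y\<close> each produce \<open>V L / b\<close>; the term
  \<open>W\<close> produces the product of the volumes \<open>V (R + r0)\<close> and
  \<open>V L\<close>.\<close>

lemma nonlocal_energy_change_range:
  fixes M :: "'a::euclidean_space set" and v :: "'a \<Rightarrow> real" and p r L R b r0 :: real
  assumes p: "1 \<le> p" and M [measurable]: "M \<in> sets borel" and v [measurable]: "v \<in> borel_measurable borel"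
    and vint: "\<And>x. set_integrable lborel (M \<inter> ball x r0) v"
    and dens: "\<And>x. x \<in> M \<Longrightarrow> b \<le> measure lborel (M \<inter> ball x r0)" and b: "0 < b"
    and r0: "0 < r0" and r1: "0 < r1" and r: "2 * r0 + r1 \<le> r"
    and L: "L \<le> R" and cov: "covering_bound TYPE('a) R (r - 2 * r0) n"
    and chain: "\<And>x y. x \<in> M \<Longrightarrow> y \<in> M \<Longrightarrow> dist x y < L \<Longrightarrow> (x, y) \<in> (hops (M \<inter> ball x R) r1)\<^sup>*"
  defines "V \<equiv> \<lambda>s. measure lborel (ball (0::'a) s)"
  shows "nonlocal_energy p M L v \<le>
    ennreal (3 powr p * (2 * V L / b + real (2 * n\<^sup>2 + 1) powr p / b\<^sup>2 * V (R + r0) * V L))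
    * nonlocal_energy p M r v"
proof -
  define g where "g x = (\<integral>\<^sup>+y. nonlocal_density p M r v x y \<partial>lborel)" for x
  have gm [measurable]: "g \<in> borel_measurable borel"
    unfolding g_def using lborel.borel_measurable_nn_integral[of "nonlocal_density p M r v" borel] by simp
  define k where "k = real (2 * n\<^sup>2 + 1) powr p / b\<^sup>2"
  define W where "W x = (\<integral>\<^sup>+\<xi>. (if dist x \<xi> < R + r0 then g \<xi> else 0) \<partial>lborel)" for x
  have Wm [measurable]: "W \<in> borel_measurable borel"
    unfolding W_def by measurable
  define I where "I = nonlocal_energy p M r v"
  have I: "(\<integral>\<^sup>+x. g x \<partial>lborel) = I" by (simp add: I_def g_def nonlocal_energy_def)
  define J :: "'a \<Rightarrow> 'a \<Rightarrow> ennreal" where "J x y = (if dist x y < L then 1 else 0)" for x y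
  have chim [measurable]: "(\<lambda>z. J (fst z) (snd z)) \<in> borel_measurable (borel \<Otimes>\<^sub>M borel)"
    "(\<lambda>y. J x y) \<in> borel_measurable borel" "(\<lambda>y. J y x) \<in> borel_measurable borel" for x
    unfolding J_def by measurable
  have V: "V s \<ge> 0" for s by (simp add: V_def)
  have chi: "(\<integral>\<^sup>+y. c * J x y \<partial>lborel) = c * ennreal (V L)" for x c
    using nn_integral_dist_less[of x L c] unfolding J_def V_def
    by (simp add: if_distrib[of "(*) c"] cong: if_cong)
  have pt: "nonlocal_density p M L v x y \<le>
      ennreal (3 powr p) * (g x / ennreal b + g y / ennreal b + ennreal k * W x) * J x y" for x y
  proof (cases "x \<in> M \<and> y \<in> M \<and> dist x y < L")
    case True
    then have xR: "x \<in> ball x R" "y \<in> ball x R" using L zero_le_dist[of x y] by (auto simp: not_le[symmetric] simp del: zero_le_dist)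
    have "ennreal (\<bar>v x - v y\<bar> powr p) \<le>
        ennreal (3 powr p) * (g x / ennreal b + g y / ennreal b + ennreal k * W x)"
      using nonlocal_difference_le[OF p M v vint dens b r0 r1 r cov _ xR(1) _ xR(2) chain] True
      unfolding k_def W_def g_def by blast
    then show ?thesis using True by (simp add: nonlocal_density_def J_def)
  qed (auto simp: nonlocal_density_def)
  \<comment> \<open>After exchanging the integrals, each \<open>g \<xi>\<close> is weighted by the
    volume of the ball of centres \<open>x\<close> that see \<open>\<xi>\<close>.\<close>
  have intW: "(\<integral>\<^sup>+x. W x \<partial>lborel) = I * ennreal (V (R + r0))"
  proof -
    have "(\<integral>\<^sup>+x. W x \<partial>lborel) = (\<integral>\<^sup>+\<xi>. \<integral>\<^sup>+x. (if dist x \<xi> < R + r0 then g \<xi> else 0) \<partial>lborel \<partial>lborel)"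
      unfolding W_def by (rule lborel_pair.Fubini') measurable
    also have "\<dots> = (\<integral>\<^sup>+\<xi>. g \<xi> * ennreal (V (R + r0)) \<partial>lborel)"
    proof (intro nn_integral_cong)
      fix \<xi>
      show "(\<integral>\<^sup>+x. (if dist x \<xi> < R + r0 then g \<xi> else 0) \<partial>lborel) = g \<xi> * ennreal (V (R + r0))"
        using nn_integral_dist_less[of \<xi> "R + r0" "g \<xi>"] unfolding V_def by (simp only: dist_commute)
    qed
    also have "\<dots> = I * ennreal (V (R + r0))" unfolding I[symmetric] by (rule nn_integral_multc) measurable
    finally show ?thesis .
  qed
  have b1: "(\<integral>\<^sup>+x. \<integral>\<^sup>+y. g x / ennreal b * J x y \<partial>lborel \<partial>lborel) = I / ennreal b * ennreal (V L)"
    unfolding chi I[symmetric] by (simp add: nn_integral_multc nn_integral_divide)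
  \<comment> \<open>Tonelli and the symmetry of \<open>J\<close> reduce this to
    \<open>b1\<close>.\<close>
  have b2: "(\<integral>\<^sup>+x. \<integral>\<^sup>+y. g y / ennreal b * J x y \<partial>lborel \<partial>lborel) = I / ennreal b * ennreal (V L)"
  proof -
    have "(\<integral>\<^sup>+x. \<integral>\<^sup>+y. g y / ennreal b * J x y \<partial>lborel \<partial>lborel)
        = (\<integral>\<^sup>+y. \<integral>\<^sup>+x. g y / ennreal b * J x y \<partial>lborel \<partial>lborel)"
      unfolding J_def by (rule lborel_pair.Fubini') measurable
    also have "\<dots> = (\<integral>\<^sup>+y. \<integral>\<^sup>+x. g y / ennreal b * J y x \<partial>lborel \<partial>lborel)"
      by (simp add: J_def dist_commute)
    finally show ?thesis using b1 by simp
  qed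
  have b3: "(\<integral>\<^sup>+x. \<integral>\<^sup>+y. ennreal k * W x * J x y \<partial>lborel \<partial>lborel) = ennreal k * (I * ennreal (V (R + r0))) * ennreal (V L)"
    unfolding chi by (simp add: nn_integral_multc nn_integral_cmult intW)
  have "nonlocal_energy p M L v \<le> (\<integral>\<^sup>+x. \<integral>\<^sup>+y.
      ennreal (3 powr p) * (g x / ennreal b + g y / ennreal b + ennreal k * W x) * J x y \<partial>lborel \<partial>lborel)"
    unfolding nonlocal_energy_def by (intro nn_integral_mono pt)
  also have "\<dots> = (\<integral>\<^sup>+x. \<integral>\<^sup>+y. ennreal (3 powr p) *
      (g x / ennreal b * J x y + g y / ennreal b * J x y + ennreal k * W x * J x y) \<partial>lborel \<partial>lborel)"
    by (simp add: distrib_right mult.assoc)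
  also have "\<dots> = ennreal (3 powr p) * ((\<integral>\<^sup>+x. \<integral>\<^sup>+y. g x / ennreal b * J x y \<partial>lborel \<partial>lborel)
      + (\<integral>\<^sup>+x. \<integral>\<^sup>+y. g y / ennreal b * J x y \<partial>lborel \<partial>lborel)
      + (\<integral>\<^sup>+x. \<integral>\<^sup>+y. ennreal k * W x * J x y \<partial>lborel \<partial>lborel))"
    unfolding J_def by (simp add: nn_integral_cmult nn_integral_add)
  also have "\<dots> = ennreal (3 powr p * (2 * V L / b + k * V (R + r0) * V L)) * I"
  proof -
    define \<alpha> where "\<alpha> = V L / b"
    define \<beta> where "\<beta> = k * V (R + r0) * V L"
    have kn: "0 \<le> k" by (simp add: k_def)
    have nn: "0 \<le> \<alpha>" "0 \<le> \<beta>" using V[of L] V[of "R + r0"] b by (simp_all add: \<alpha>_def \<beta>_def k_def)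
    have 1: "I / ennreal b * ennreal (V L) = ennreal \<alpha> * I"
      using b V[of L] unfolding \<alpha>_def divide_ennreal_def
      by (simp add: inverse_ennreal mult_ac divide_inverse ennreal_mult)
    have 2: "ennreal k * (I * ennreal (V (R + r0))) * ennreal (V L) = ennreal \<beta> * I"
      using V[of L] V[of "R + r0"] kn unfolding \<beta>_def by (simp add: mult_ac ennreal_mult)
    have "3 powr p * (2 * V L / b + k * V (R + r0) * V L) = 3 powr p * (\<alpha> + \<alpha> + \<beta>)"
      by (simp add: \<alpha>_def \<beta>_def)
    moreover have "ennreal (3 powr p * (\<alpha> + \<alpha> + \<beta>)) = ennreal (3 powr p) * ennreal (\<alpha> + \<alpha> + \<beta>)"
      using nn by (intro ennreal_mult) auto
    moreover have "ennreal (\<alpha> + \<alpha> + \<beta>) = ennreal \<alpha> + ennreal \<alpha> + ennreal \<beta>"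
      using nn by (simp only: ennreal_plus add_nonneg_nonneg)
    ultimately have "ennreal (3 powr p * (2 * V L / b + k * V (R + r0) * V L)) * I
        = ennreal (3 powr p) * (ennreal \<alpha> + ennreal \<alpha> + ennreal \<beta>) * I"
      by (simp only:)
    then show ?thesis unfolding b1 b2 b3 1 2 by (simp add: distrib_right mult.assoc)
  qed
  finally show ?thesis unfolding I_def k_def .
qed

subsection \<open>Extension by cell averages\<close>

text \<open>The half-open grid cube of side \<open>2 * s\<close> containing \<open>x\<close>.
  Equality of floors makes membership an equivalence relation, so cells partition the space and two
  cells with a common point coincide.\<close>

definition cell :: "real \<Rightarrow> real ^ 'd \<Rightarrow> (real ^ 'd) set" where
  "cell s x = {y. \<forall>i. \<lfloor>y $ i / (2 * s)\<rfloor> = \<lfloor>x $ i / (2 * s)\<rfloor>}"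

text \<open>The average is taken with respect to \<open>lebesgue\<close> since \<open>u\<close> is a
  Lebesgue measurable representative; for Borel functions \<open>cell_extension_lborel\<close> turns
  it into an \<open>lborel\<close> average.\<close>

definition cell_extension :: "(real ^ 'd) set \<Rightarrow> real \<Rightarrow> (real ^ 'd \<Rightarrow> real) \<Rightarrow> real ^ 'd \<Rightarrow> real" where
  "cell_extension M s u x =
     (if x \<in> M then u x else (LINT y:M \<inter> cell s x|lebesgue. u y) / measure lebesgue (M \<inter> cell s x))"

lemma cell_commute: "y \<in> cell s x \<longleftrightarrow> x \<in> cell s y"
  by (auto simp: cell_def)

lemma cell_eq: "y \<in> cell s x \<Longrightarrow> cell s y = cell s x"
  by (auto simp: cell_def)

text \<open>Measurability is needed jointly in both points, since Tonelli is later applied to pairs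
  lying in a common cell.\<close>

lemma measurable_cell [measurable]:
  fixes f g :: "'a \<Rightarrow> real ^ 'd"
  assumes [measurable]: "f \<in> measurable N borel" "g \<in> measurable N borel"
  shows "Measurable.pred N (\<lambda>z. g z \<in> cell s (f z))"
proof -
  have [measurable]: "(\<lambda>x::real ^ 'd. x $ i) \<in> borel_measurable borel" for i
    by (intro borel_measurable_continuous_onI continuous_intros)
  show ?thesis unfolding cell_def by measurable
qed

lemma borel_cell [measurable]: "cell s x \<in> sets borel"
proof -
  have "{y \<in> space borel. y \<in> cell s x} \<in> sets borel" by measurable
  then show ?thesis by simp
qed

lemma cell_sandwich:
  fixes x :: "real ^ 'd"
  assumes s: "0 < s"
  defines "c \<equiv> \<chi> i. 2 * s * real_of_int \<lfloor>x $ i / (2 * s)\<rfloor> + s"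
  shows "cell s x \<subseteq> cube c s" and "box (c - (\<chi> i. s)) (c + (\<chi> i. s)) \<subseteq> cell s x"
proof -
  have *: "\<lfloor>t / (2 * s)\<rfloor> = n \<longleftrightarrow> 2 * s * n \<le> t \<and> t < 2 * s * n + 2 * s" for t n
    using s by (simp add: floor_eq_iff pos_le_divide_eq pos_divide_less_eq algebra_simps)
  have cell: "y \<in> cell s x \<longleftrightarrow> (\<forall>i. c $ i - s \<le> y $ i \<and> y $ i < c $ i + s)" for y
    unfolding cell_def * by (simp add: c_def algebra_simps)
  show "cell s x \<subseteq> cube c s" "box (c - (\<chi> i. s)) (c + (\<chi> i. s)) \<subseteq> cell s x"
    unfolding subset_iff cell cube_def by (simp_all add: mem_box_cart less_imp_le)
qed

lemma dist_le_of_mem_cell: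
  fixes x y :: "real ^ 'd"
  assumes s: "0 < s" and y: "y \<in> cell s x"
  shows "dist x y \<le> 2 * s * CARD('d)"
proof -
  have "x \<in> cell s x" by (simp add: cell_def)
  then obtain c where "x \<in> cube c s" "y \<in> cube c s" using cell_sandwich(1)[OF s, of x] y by blast
  then show ?thesis
    using dist_le_of_mem_cube[of x c s] dist_le_of_mem_cube[of y c s] dist_triangle3[of x y c] by linarith
qed

lemma bounded_cell: "0 < s \<Longrightarrow> bounded (cell s x)"
  by (rule bounded_subset[OF _ cell_sandwich(1)]) (simp_all add: cube_def)

text \<open>The half-open cell and the closed cube with the same centre differ inside the frontier
  of a box, a null set. This transfers bounds for closed cubes, over which the supremum in
  \<open>const_c1\<close> is taken, to cells.\<close>

lemma cell_measure_eq_cube: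
  fixes M :: "(real ^ 'd) set"
  assumes s: "0 < s" and M [measurable]: "M \<in> sets borel"
  obtains c where "measure lborel (M \<inter> cell s x) = measure lebesgue (M \<inter> cube c s)"
    "measure lborel (cell s x - M) = measure lebesgue (cube c s - M)"
proof -
  define c :: "real ^ 'd" where "c = (\<chi> i. 2 * s * real_of_int \<lfloor>x $ i / (2 * s)\<rfloor> + s)"
  have sub: "cell s x \<subseteq> cube c s" "box (c - (\<chi> i. s)) (c + (\<chi> i. s)) \<subseteq> cell s x"
    using cell_sandwich[OF s, of x] by (simp_all add: c_def)
  have neg: "negligible (cube c s - cell s x)"
    using negligible_frontier_interval[of "c - (\<chi> i. s)" "c + (\<chi> i. s)", folded cube_def]
    by (rule negligible_subset) (use sub in blast)
  have cm: "cube c s \<in> lmeasurable" by (simp add: cube_def)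
  have Ms: "M \<in> sets lebesgue" by simp
  have *: "M \<inter> cube c s \<in> lmeasurable" "cube c s - M \<in> lmeasurable"
    using fmeasurable_Int_fmeasurable[OF cm Ms] fmeasurable_Diff[OF cm Ms] by (simp_all add: Int_commute)
  have "measure lebesgue (M \<inter> cell s x) = measure lebesgue (M \<inter> cube c s)"
    by (rule measure_negligible_symdiff[OF *(1)], rule negligible_subset[OF neg]) (use sub in blast)
  moreover have "measure lebesgue (cell s x - M) = measure lebesgue (cube c s - M)"
    by (rule measure_negligible_symdiff[OF *(2)], rule negligible_subset[OF neg]) (use sub in blast)
  moreover have "measure lebesgue (M \<inter> cell s x) = measure lborel (M \<inter> cell s x)"
    "measure lebesgue (cell s x - M) = measure lborel (cell s x - M)"
    by (intro measure_completion; simp)+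
  ultimately show ?thesis using that by metis
qed

lemma cell_extension_lborel:
  assumes [measurable]: "M \<in> sets borel" "v \<in> borel_measurable borel"
  shows "cell_extension M s v x =
    (if x \<in> M then v x else (LINT y:M \<inter> cell s x|lborel. v y) / measure lborel (M \<inter> cell s x))"
proof -
  have "(\<lambda>y. indicator (M \<inter> cell s x) y *\<^sub>R v y) \<in> borel_measurable lborel" by simp
  then have "(LINT y:M \<inter> cell s x|lebesgue. v y) = (LINT y:M \<inter> cell s x|lborel. v y)"
    unfolding set_lebesgue_integral_def by (rule integral_completion)
  moreover have "measure lebesgue (M \<inter> cell s x) = measure lborel (M \<inter> cell s x)"
    by (intro measure_completion) simp
  ultimately show ?thesis by (simp add: cell_extension_def)
qed

text \<open>The measure of the varying section is a parameter integral of a jointly measurable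
  function of \<open>x\<close> and \<open>y\<close>.\<close>

lemma measurable_measure_cell:
  fixes M :: "(real ^ 'd) set"
  assumes M [measurable]: "M \<in> sets borel"
  shows "(\<lambda>x. measure lborel (M \<inter> cell s x)) \<in> borel_measurable borel"
proof -
  have "emeasure lborel (M \<inter> cell s x) = (\<integral>\<^sup>+y. (if y \<in> M \<and> y \<in> cell s x then 1 else 0) \<partial>lborel)" for x
  proof -
    have "emeasure lborel (M \<inter> cell s x) = (\<integral>\<^sup>+y. indicator (M \<inter> cell s x) y \<partial>lborel)"
      by (rule nn_integral_indicator[symmetric]) simp
    also have "\<dots> = (\<integral>\<^sup>+y. (if y \<in> M \<and> y \<in> cell s x then 1 else 0) \<partial>lborel)"
      by (intro nn_integral_cong) (auto simp: indicator_def)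
    finally show ?thesis .
  qed
  then have "(\<lambda>x. measure lborel (M \<inter> cell s x))
      = (\<lambda>x. enn2real (\<integral>\<^sup>+y. (if y \<in> M \<and> y \<in> cell s x then 1 else 0) \<partial>lborel))"
    by (simp add: measure_def)
  also have "\<dots> \<in> borel_measurable borel" by measurable
  finally show ?thesis .
qed

lemma borel_measurable_cell_extension:
  fixes M :: "(real ^ 'd) set"
  assumes M [measurable]: "M \<in> sets borel" and v [measurable]: "v \<in> borel_measurable borel"
  shows "cell_extension M s v \<in> borel_measurable borel"
proof -
  note measurable_measure_cell[OF M, measurable]
  have eq: "(\<lambda>x. LINT y:M \<inter> cell s x|lborel. v y)
      = (\<lambda>x. LINT y|lborel. (if y \<in> M \<and> y \<in> cell s x then v y else 0))"
    unfolding set_lebesgue_integral_def by (intro ext Bochner_Integration.integral_cong) (auto simp: indicator_def)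
  have [measurable]: "(\<lambda>x. LINT y:M \<inter> cell s x|lborel. v y) \<in> borel_measurable borel"
    unfolding eq by measurable
  show ?thesis unfolding cell_extension_lborel[OF M v, abs_def] by measurable
qed

text \<open>The geometric input of the extension estimates. With \<open>c1 - 1\<close> in
  \<open>ratio\<close>, the values on \<open>M\<close> itself account for the remaining one in the
  factor \<open>c1\<close>.\<close>

locale cell_filling =
  fixes M :: "(real ^ 'd) set" and p s c1 :: real
  assumes p: "1 \<le> p" and s: "0 < s" and c1: "1 \<le> c1" and M [measurable]: "M \<in> sets borel"
    and pos: "\<And>x. 0 < measure lborel (M \<inter> cell s x)"
    and ratio: "\<And>x. measure lborel (cell s x - M) \<le> (c1 - 1) * measure lborel (M \<inter> cell s x)"
begin

text \<open>Off \<open>M\<close>, Jensen spreads the value at \<open>x\<close> over the points of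
  \<open>M\<close> in its cell. By Tonelli each such point receives total weight at most
  \<open>c1 - 1\<close>, besides its own weight one. The weight \<open>w'\<close> absorbs the
  displacement inside a cell: constant weights give the norm bound, distance cutoffs the energy
  bound.\<close>

lemma nn_integral_cell_extension_le:
  assumes v [measurable]: "v \<in> borel_measurable borel"
    and vint: "\<And>x. set_integrable lborel (M \<inter> cell s x) v"
    and w [measurable]: "w \<in> borel_measurable borel" and w' [measurable]: "w' \<in> borel_measurable borel"
    and ww': "\<And>x y. y \<in> cell s x \<Longrightarrow> w x \<le> (w' y :: ennreal)"
  shows "(\<integral>\<^sup>+x. w x * ennreal (\<bar>cell_extension M s v x - c\<bar> powr p) \<partial>lborel)
    \<le> ennreal c1 * (\<integral>\<^sup>+x. (if x \<in> M then w' x * ennreal (\<bar>v x - c\<bar> powr p) else 0) \<partial>lborel)"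
proof -
  define \<mu> where "\<mu> x = measure lborel (M \<inter> cell s x)" for x
  have [measurable]: "\<mu> \<in> borel_measurable borel"
    unfolding \<mu>_def by (rule measurable_measure_cell[OF M])
  have mu: "\<mu> x > 0" for x using pos by (simp add: \<mu>_def)
  define N where "N y = w' y * ennreal (\<bar>v y - c\<bar> powr p)" for y
  have [measurable]: "N \<in> borel_measurable borel" unfolding N_def by measurable
  \<comment> \<open>The share of \<open>y\<close> in the average at \<open>x\<close>. Dividing by
    \<open>\<mu> y\<close>, equal to \<open>\<mu> x\<close> within a cell, leaves a factor that is
    constant during integration over \<open>x\<close>.\<close>
  define Q where "Q x y = (if x \<notin> M \<and> y \<in> M \<and> y \<in> cell s x then N y / ennreal (\<mu> y) else 0)" for x y
  have [measurable]: "(\<lambda>z. Q (f z) (g z)) \<in> borel_measurable K"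
    if [measurable]: "f \<in> measurable K borel" "g \<in> measurable K borel" for f g and K :: "'b measure"
    unfolding Q_def by measurable
  have Qm: "case_prod Q \<in> borel_measurable (lborel \<Otimes>\<^sub>M lborel)"
    unfolding Q_def by measurable
  have fin: "emeasure lborel (M \<inter> cell s x) < \<infinity>" "emeasure lborel (cell s x - M) < \<infinity>" for x
    using emeasure_bounded_finite[of "M \<inter> cell s x"] emeasure_bounded_finite[of "cell s x - M"]
      bounded_cell[OF s, of x] by (simp_all add: bounded_Int bounded_diff)
  have pt: "w x * ennreal (\<bar>cell_extension M s v x - c\<bar> powr p)
      \<le> (if x \<in> M then N x else 0) + (\<integral>\<^sup>+y. Q x y \<partial>lborel)" for x
  proof (cases "x \<in> M")
    case True
    have "w x \<le> w' x" by (rule ww') (simp add: cell_def)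
    then show ?thesis using True
      by (simp add: cell_extension_def N_def mult_right_mono add_increasing2)
  next
    case False
    have "ennreal (\<bar>cell_extension M s v x - c\<bar> powr p)
        \<le> (\<integral>\<^sup>+y\<in>M \<inter> cell s x. ennreal (\<bar>v y - c\<bar> powr p) \<partial>lborel) / ennreal (\<mu> x)"
      using False pos[of x] fin vint unfolding cell_extension_lborel[OF M v] \<mu>_def
      by (simp add: jensen_set_average[OF p])
    then have "w x * ennreal (\<bar>cell_extension M s v x - c\<bar> powr p)
        \<le> w x * ((\<integral>\<^sup>+y\<in>M \<inter> cell s x. ennreal (\<bar>v y - c\<bar> powr p) \<partial>lborel) / ennreal (\<mu> x))"
      by (rule mult_left_mono) simp
    also have "\<dots> = (\<integral>\<^sup>+y. w x * (ennreal (\<bar>v y - c\<bar> powr p) * indicator (M \<inter> cell s x) y) / ennreal (\<mu> x) \<partial>lborel)"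
      by (simp add: nn_integral_divide nn_integral_cmult ennreal_times_divide)
    also have "\<dots> \<le> (\<integral>\<^sup>+y. Q x y \<partial>lborel)"
    proof (intro nn_integral_mono)
      fix y
      show "w x * (ennreal (\<bar>v y - c\<bar> powr p) * indicator (M \<inter> cell s x) y) / ennreal (\<mu> x) \<le> Q x y"
      proof (cases "y \<in> M \<inter> cell s x")
        case True
        then have "\<mu> y = \<mu> x" "w x \<le> w' y" using cell_eq[of y s x] ww'[of y x] by (auto simp: \<mu>_def)
        then show ?thesis using True False
          by (simp add: Q_def N_def divide_right_mono_ennreal mult_right_mono)
      qed simp
    qed
    finally show ?thesis using False by simp
  qed
  have Qint: "(\<integral>\<^sup>+x. Q x y \<partial>lborel) \<le> ennreal (c1 - 1) * (if y \<in> M then N y else 0)" for y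
  proof (cases "y \<in> M")
    case True
    have "Q x y = N y / ennreal (\<mu> y) * indicator (cell s y - M) x" for x
      using True by (auto simp: Q_def indicator_def cell_commute)
    then have "(\<integral>\<^sup>+x. Q x y \<partial>lborel) = N y / ennreal (\<mu> y) * emeasure lborel (cell s y - M)"
      by (simp add: nn_integral_cmult_indicator)
    also have "\<dots> = N y * (emeasure lborel (cell s y - M) / ennreal (\<mu> y))"
      by (rule ennreal_divide_times)
    also have "\<dots> \<le> N y * ennreal (c1 - 1)"
    proof (rule mult_left_mono)
      have "measure lborel (cell s y - M) / \<mu> y \<le> c1 - 1"
        using ratio[of y] mu[of y] by (simp add: \<mu>_def pos_divide_le_eq)
      then show "emeasure lborel (cell s y - M) / ennreal (\<mu> y) \<le> ennreal (c1 - 1)"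
        using mu[of y] fin(2)[of y]
        by (simp add: emeasure_eq_ennreal_measure divide_ennreal ennreal_leI)
    qed simp
    finally show ?thesis using True by (simp add: mult.commute)
  qed (simp add: Q_def)
  define E where "E = (\<integral>\<^sup>+x. (if x \<in> M then N x else 0) \<partial>lborel)"
  have "(\<integral>\<^sup>+x. \<integral>\<^sup>+y. Q x y \<partial>lborel \<partial>lborel) = (\<integral>\<^sup>+y. \<integral>\<^sup>+x. Q x y \<partial>lborel \<partial>lborel)"
    by (rule lborel_pair.Fubini'[OF Qm, symmetric])
  also have "\<dots> \<le> (\<integral>\<^sup>+y. ennreal (c1 - 1) * (if y \<in> M then N y else 0) \<partial>lborel)"
    by (intro nn_integral_mono Qint)
  also have "\<dots> = ennreal (c1 - 1) * E"
    unfolding E_def by (rule nn_integral_cmult) measurable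
  finally have off: "(\<integral>\<^sup>+x. \<integral>\<^sup>+y. Q x y \<partial>lborel \<partial>lborel) \<le> ennreal (c1 - 1) * E" .
  have "(\<integral>\<^sup>+x. w x * ennreal (\<bar>cell_extension M s v x - c\<bar> powr p) \<partial>lborel)
      \<le> (\<integral>\<^sup>+x. (if x \<in> M then N x else 0) + (\<integral>\<^sup>+y. Q x y \<partial>lborel) \<partial>lborel)"
    by (intro nn_integral_mono pt)
  also have "\<dots> = E + (\<integral>\<^sup>+x. \<integral>\<^sup>+y. Q x y \<partial>lborel \<partial>lborel)"
    unfolding E_def by (intro nn_integral_add) measurable
  also have "\<dots> \<le> E + ennreal (c1 - 1) * E" using off by (rule add_left_mono)
  also have "\<dots> = ennreal c1 * E"
  proof -
    have "ennreal c1 = 1 + ennreal (c1 - 1)"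
      using c1 by (simp add: ennreal_1[symmetric] ennreal_plus[symmetric] del: ennreal_1 ennreal_plus)
    then show ?thesis by (simp add: distrib_right)
  qed
  finally show ?thesis unfolding E_def N_def .
qed

text \<open>The weighted estimate is applied once in each variable. Each application costs
  \<open>c1\<close> and enlarges the range by the bound \<open>2 * s * CARD('d)\<close> for the
  diameter of a cell.\<close>

lemma nonlocal_energy_cell_extension_le:
  assumes v [measurable]: "v \<in> borel_measurable borel"
    and vint: "\<And>x. set_integrable lborel (M \<inter> cell s x) v"
  shows "nonlocal_energy p UNIV h (cell_extension M s v)
    \<le> ennreal (c1\<^sup>2) * nonlocal_energy p M (h + 2 * (2 * s * CARD('d))) v"
proof -
  define T where "T = cell_extension M s v"
  have [measurable]: "T \<in> borel_measurable borel"
    unfolding T_def by (rule borel_measurable_cell_extension[OF M v])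
  define \<delta> where "\<delta> = 2 * s * CARD('d)"
  define J :: "real \<Rightarrow> real ^ 'd \<Rightarrow> real ^ 'd \<Rightarrow> ennreal" where "J r x y = (if dist x y < r then 1 else 0)" for r x y
  have [measurable]: "(\<lambda>z. J r (f z) (g z)) \<in> borel_measurable N"
    if [measurable]: "f \<in> measurable N borel" "g \<in> measurable N borel" for r f g and N :: "'b measure"
    unfolding J_def by measurable
  have grow: "J r x z \<le> J (r + \<delta>) y z" if "y \<in> cell s x" for r x y z
    using dist_le_of_mem_cell[OF s that] dist_triangle3[of y z x] unfolding J_def \<delta>_def
    by (auto simp: dist_commute)
  have step: "(\<integral>\<^sup>+x. J r x z * ennreal (\<bar>T x - c\<bar> powr p) \<partial>lborel)
    \<le> ennreal c1 * (\<integral>\<^sup>+x. (if x \<in> M then J (r + \<delta>) x z * ennreal (\<bar>v x - c\<bar> powr p) else 0) \<partial>lborel)" for r z c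
    unfolding T_def
    by (rule nn_integral_cell_extension_le[OF v vint]) (measurable, rule grow)
  define h1 where "h1 = h + \<delta>"
  \<comment> \<open>The intermediate energy: the first argument has been moved into
    \<open>M\<close>, while the second still carries the extension.\<close>
  define E where "E = (\<integral>\<^sup>+x. \<integral>\<^sup>+y. (if x \<in> M then J h1 x y * ennreal (\<bar>v x - T y\<bar> powr p) else 0) \<partial>lborel \<partial>lborel)"
  have "nonlocal_energy p UNIV h T = (\<integral>\<^sup>+y. \<integral>\<^sup>+x. J h x y * ennreal (\<bar>T x - T y\<bar> powr p) \<partial>lborel \<partial>lborel)"
    unfolding nonlocal_energy_def nonlocal_density_def J_def
    by (intro nn_integral_cong) (simp add: dist_commute abs_minus_commute)
  also have "\<dots> \<le> (\<integral>\<^sup>+y. ennreal c1 * (\<integral>\<^sup>+x. (if x \<in> M then J h1 x y * ennreal (\<bar>v x - T y\<bar> powr p) else 0) \<partial>lborel) \<partial>lborel)"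
    unfolding h1_def by (intro nn_integral_mono step)
  also have "\<dots> = ennreal c1 * (\<integral>\<^sup>+y. \<integral>\<^sup>+x. (if x \<in> M then J h1 x y * ennreal (\<bar>v x - T y\<bar> powr p) else 0) \<partial>lborel \<partial>lborel)"
    by (rule nn_integral_cmult) measurable
  also have "(\<integral>\<^sup>+y. \<integral>\<^sup>+x. (if x \<in> M then J h1 x y * ennreal (\<bar>v x - T y\<bar> powr p) else 0) \<partial>lborel \<partial>lborel) = E"
    unfolding E_def by (rule lborel_pair.Fubini') measurable
  finally have first: "nonlocal_energy p UNIV h T \<le> ennreal c1 * E" .
  have "E \<le> (\<integral>\<^sup>+x. ennreal c1 * (\<integral>\<^sup>+y. nonlocal_density p M (h1 + \<delta>) v x y \<partial>lborel) \<partial>lborel)"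
    unfolding E_def
  proof (intro nn_integral_mono)
    fix x
    show "(\<integral>\<^sup>+y. (if x \<in> M then J h1 x y * ennreal (\<bar>v x - T y\<bar> powr p) else 0) \<partial>lborel)
       \<le> ennreal c1 * (\<integral>\<^sup>+y. nonlocal_density p M (h1 + \<delta>) v x y \<partial>lborel)"
    proof (cases "x \<in> M")
      case True
      have "(\<integral>\<^sup>+y. (if x \<in> M then J h1 x y * ennreal (\<bar>v x - T y\<bar> powr p) else 0) \<partial>lborel)
          = (\<integral>\<^sup>+y. J h1 y x * ennreal (\<bar>T y - v x\<bar> powr p) \<partial>lborel)"
        using True by (simp add: J_def dist_commute abs_minus_commute)
      also have "\<dots> \<le> ennreal c1 * (\<integral>\<^sup>+y. (if y \<in> M then J (h1 + \<delta>) y x * ennreal (\<bar>v y - v x\<bar> powr p) else 0) \<partial>lborel)"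
        by (rule step)
      also have "(\<lambda>y. if y \<in> M then J (h1 + \<delta>) y x * ennreal (\<bar>v y - v x\<bar> powr p) else 0)
          = nonlocal_density p M (h1 + \<delta>) v x"
        using True by (auto simp: J_def nonlocal_density_def dist_commute abs_minus_commute)
      finally show ?thesis .
    qed simp
  qed
  also have "\<dots> = ennreal c1 * nonlocal_energy p M (h1 + \<delta>) v"
    unfolding nonlocal_energy_def by (rule nn_integral_cmult) measurable
  finally have "ennreal c1 * E \<le> ennreal c1 * (ennreal c1 * nonlocal_energy p M (h1 + \<delta>) v)"
    by (rule mult_left_mono) simp
  also have "\<dots> = ennreal (c1\<^sup>2) * nonlocal_energy p M (h + 2 * \<delta>) v"
    using c1 by (simp add: power2_eq_square ennreal_mult mult.assoc h1_def add.assoc)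
  finally show ?thesis using first unfolding T_def \<delta>_def by (rule order_trans[rotated])
qed

end

subsection \<open>From Borel functions to Lebesgue measurable functions\<close>

text \<open>The exceptional set is enlarged to a Borel null set \<open>N\<close>; outside
  \<open>N\<close> in each coordinate the property holds, and Tonelli makes the remaining pairs
  null.\<close>

lemma AE_lborel_fst_snd:
  assumes "AE x in lborel. P (x::'a::euclidean_space)"
  shows "AE z in (lborel :: ('a \<times> 'a) measure). P (fst z) \<and> P (snd z)"
proof -
  obtain N where N: "N \<in> null_sets lborel" "{x \<in> space lborel. \<not> P x} \<subseteq> N"
    using assms unfolding eventually_ae_filter by blast
  then have [measurable]: "N \<in> sets borel" by auto
  have AEN: "AE x in lborel. x \<notin> N" using N(1) by (rule AE_not_in)
  have "AE z in (lborel :: 'a measure) \<Otimes>\<^sub>M lborel. fst z \<notin> N \<and> snd z \<notin> N"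
  proof (rule lborel_pair.AE_pair_measure)
    show "AE x in lborel. AE y in lborel. fst (x, y) \<notin> N \<and> snd (x, y) \<notin> N"
      using AEN by eventually_elim (use AEN in simp)
  qed measurable
  then show ?thesis unfolding lborel_prod by eventually_elim (use N(2) in auto)
qed

text \<open>Nonnegative integrals agree for a measure and its completion, and changing
  \<open>u\<close> on a null set changes the integrand only on a null set of pairs. The Borel
  function \<open>v\<close> then permits an iterated integral.\<close>

lemma nn_integral_diag_nbhd:
  fixes M :: "(real ^ 'd) set"
  assumes M [measurable]: "M \<in> sets borel" and v [measurable]: "v \<in> borel_measurable borel"
    and uv: "AE x in lborel. x \<in> M \<longrightarrow> u x = v x"
  shows "(\<integral>\<^sup>+z\<in>(M \<times> M) \<inter> diag_nbhd h. ennreal (\<bar>u (fst z) - u (snd z)\<bar> powr p) \<partial>lebesgue)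
    = nonlocal_energy p M h v"
proof -
  have "(\<integral>\<^sup>+z\<in>(M \<times> M) \<inter> diag_nbhd h. ennreal (\<bar>u (fst z) - u (snd z)\<bar> powr p) \<partial>lebesgue)
      = (\<integral>\<^sup>+z. nonlocal_density p M h v (fst z) (snd z) \<partial>lborel)"
    unfolding nn_integral_completion
  proof (rule nn_integral_cong_AE)
    show "AE z in lborel. ennreal (\<bar>u (fst z) - u (snd z)\<bar> powr p) * indicator ((M \<times> M) \<inter> diag_nbhd h) z
        = nonlocal_density p M h v (fst z) (snd z)"
      using AE_lborel_fst_snd[OF uv]
      by eventually_elim (auto simp: nonlocal_density_def diag_nbhd_def dist_norm indicator_def)
  qed
  also have "\<dots> = (\<integral>\<^sup>+z. nonlocal_density p M h v (fst z) (snd z) \<partial>(lborel \<Otimes>\<^sub>M lborel))"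
    by (simp add: lborel_prod)
  also have "\<dots> = nonlocal_energy p M h v"
    unfolding nonlocal_energy_def by (subst lborel.nn_integral_fst[symmetric]) simp_all
  finally show ?thesis .
qed

lemma lebesgue_measurable_indicator_mult:
  assumes M: "M \<in> sets borel" and u: "u \<in> borel_measurable (lebesgue_on M)" and A: "A \<in> sets borel"
  shows "(\<lambda>x. indicator (M \<inter> A) x *\<^sub>R (u x :: real)) \<in> borel_measurable lebesgue"
proof -
  have "M \<inter> space lebesgue \<in> sets lebesgue" using M by simp
  then have [measurable]: "(\<lambda>x. indicator M x *\<^sub>R u x) \<in> borel_measurable lebesgue"
    using u by (subst borel_measurable_restrict_space_iff[symmetric]) auto
  have [measurable]: "A \<in> sets lebesgue" using A by simp
  have "(\<lambda>x. indicator A x * (indicator M x *\<^sub>R u x)) \<in> borel_measurable lebesgue" by measurable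
  also have "(\<lambda>x. indicator A x * (indicator M x *\<^sub>R u x)) = (\<lambda>x. indicator (M \<inter> A) x *\<^sub>R u x)"
    by (auto simp: indicator_def)
  finally show ?thesis .
qed

text \<open>Tonelli is used for \<open>lborel\<close>, whereas a function in
  \<open>Lp_set p (lebesgue_on M)\<close> is only Lebesgue measurable; its extension by zero agrees
  almost everywhere with a Borel function.\<close>

lemma borel_representative:
  assumes M: "M \<in> sets borel" and u: "u \<in> borel_measurable (lebesgue_on M)"
  obtains v :: "_ \<Rightarrow> real" where "v \<in> borel_measurable borel" "AE x in lborel. x \<in> M \<longrightarrow> u x = v x"
proof -
  have "(\<lambda>x. indicator M x *\<^sub>R u x) \<in> borel_measurable (completion lborel)"
    using lebesgue_measurable_indicator_mult[OF M u, of UNIV] by simp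
  from completion_ex_borel_measurable_real[OF this]
  obtain v where v: "v \<in> borel_measurable lborel" "AE x in lborel. indicator M x *\<^sub>R u x = v x" by blast
  from v(2) have "AE x in lborel. x \<in> M \<longrightarrow> u x = v x" by eventually_elim auto
  with v(1) show ?thesis using that by simp
qed

lemma nn_integral_lebesgue_on:
  assumes "M \<in> sets borel" and "AE x in lborel. x \<in> M \<longrightarrow> u x = v x"
  shows "(\<integral>\<^sup>+x. ennreal (\<bar>u x\<bar> powr p) \<partial>lebesgue_on M)
    = (\<integral>\<^sup>+x. (if x \<in> M then ennreal (\<bar>v x\<bar> powr p) else 0) \<partial>lborel)"
proof -
  have "(\<integral>\<^sup>+x. ennreal (\<bar>u x\<bar> powr p) \<partial>lebesgue_on M) = (\<integral>\<^sup>+x\<in>M. ennreal (\<bar>u x\<bar> powr p) \<partial>lebesgue)"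
    using assms(1) by (intro nn_integral_restrict_space) simp
  also have "\<dots> = (\<integral>\<^sup>+x. (if x \<in> M then ennreal (\<bar>v x\<bar> powr p) else 0) \<partial>lborel)"
    unfolding nn_integral_completion
    by (rule nn_integral_cong_AE, use assms(2) in eventually_elim) auto
  finally show ?thesis .
qed

section \<open>Functions with integrable p-th power and their cell averages\<close>

lemma Lp_set_iff_nn_integral:
  assumes "u \<in> borel_measurable N"
  shows "u \<in> Lp_set p N \<longleftrightarrow> (\<integral>\<^sup>+x. ennreal (\<bar>u x\<bar> powr p) \<partial>N) < \<infinity>"
  using assms by (auto simp: Lp_set_def integrable_iff_bounded)

lemma Lp_set_diff:
  assumes p: "1 \<le> p" and u: "u \<in> Lp_set p N" and v: "v \<in> Lp_set p N"
  shows "(\<lambda>x. u x - v x) \<in> Lp_set p N"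
proof -
  have um [measurable]: "u \<in> borel_measurable N" "v \<in> borel_measurable N" using u v by (auto simp: Lp_set_def)
  have "integrable N (\<lambda>x. \<bar>u x - v x\<bar> powr p)"
  proof (rule Bochner_Integration.integrable_bound)
    show "integrable N (\<lambda>x. 3 powr p * (\<bar>u x\<bar> powr p + \<bar>v x\<bar> powr p))"
      using u v by (simp add: Lp_set_def)
    show "AE x in N. norm (\<bar>u x - v x\<bar> powr p) \<le> norm (3 powr p * (\<bar>u x\<bar> powr p + \<bar>v x\<bar> powr p))"
    proof (intro AE_I2)
      fix x
      have "\<bar>u x - v x\<bar> powr p \<le> (\<bar>u x\<bar> + \<bar>v x\<bar> + 0) powr p" using p by (intro powr_mono2) auto
      also have "\<dots> \<le> 3 powr p * (\<bar>u x\<bar> powr p + \<bar>v x\<bar> powr p + 0 powr p)"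
        using p by (intro powr_sum3_le) auto
      finally show "norm (\<bar>u x - v x\<bar> powr p) \<le> norm (3 powr p * (\<bar>u x\<bar> powr p + \<bar>v x\<bar> powr p))" by simp
    qed
  qed measurable
  then show ?thesis by (simp add: Lp_set_def)
qed

text \<open>On a bounded set, p-integrability implies integrability through
  \<open>\<bar>t\<bar> \<le> 1 + \<bar>t\<bar> powr p\<close>; this makes all cell averages
  meaningful.\<close>

lemma Lp_set_set_integrable:
  assumes p: "1 \<le> p" and M: "M \<in> sets borel" and u: "u \<in> Lp_set p (lebesgue_on M)"
    and A: "A \<in> sets borel" "bounded A"
  shows "set_integrable lebesgue (M \<inter> A) u"
  unfolding set_integrable_def
proof (rule Bochner_Integration.integrable_bound)
  have um: "u \<in> borel_measurable (lebesgue_on M)" using u by (simp add: Lp_set_def)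
  have "integrable lebesgue (\<lambda>x. indicator M x *\<^sub>R \<bar>u x\<bar> powr p)"
    using u M by (subst integrable_restrict_space[symmetric]) (auto simp: Lp_set_def)
  moreover have "integrable lebesgue (indicator A :: _ \<Rightarrow> real)"
    using A emeasure_bounded_finite[of A] by (simp add: integrable_indicator_iff less_top)
  ultimately show "integrable lebesgue (\<lambda>x. indicator A x + indicator M x *\<^sub>R \<bar>u x\<bar> powr p)"
    by (intro Bochner_Integration.integrable_add)
  show "(\<lambda>x. indicator (M \<inter> A) x *\<^sub>R u x) \<in> borel_measurable lebesgue"
    by (rule lebesgue_measurable_indicator_mult[OF M um A(1)])
  have "\<bar>t\<bar> \<le> 1 + \<bar>t\<bar> powr p" for t :: real
  proof (cases "\<bar>t\<bar> \<le> 1")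
    case False
    then have "\<bar>t\<bar> powr 1 \<le> \<bar>t\<bar> powr p" using p by (intro powr_mono) auto
    then show ?thesis using False by simp
  qed (simp add: add_increasing2)
  then show "AE x in lebesgue. norm (indicator (M \<inter> A) x *\<^sub>R u x)
      \<le> norm (indicator A x + indicator M x *\<^sub>R \<bar>u x\<bar> powr p)"
    by (intro AE_I2) (auto simp: indicator_def)
qed

lemma set_integrable_lborel_of_AE_eq:
  fixes u v :: "'a::euclidean_space \<Rightarrow> real"
  assumes M: "M \<in> sets borel" and A: "A \<in> sets borel" and v: "v \<in> borel_measurable borel"
    and uv: "AE x in lborel. x \<in> M \<longrightarrow> u x = v x"
    and u: "set_integrable lebesgue (M \<inter> A) u"
  shows "set_integrable lborel (M \<inter> A) v"
proof -
  have vm: "(\<lambda>x. indicator (M \<inter> A) x *\<^sub>R v x) \<in> borel_measurable lborel"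
    using M A v by simp
  have "AE x in lebesgue. indicator (M \<inter> A) x *\<^sub>R u x = indicator (M \<inter> A) x *\<^sub>R v x"
    using AE_completion[OF uv] by eventually_elim auto
  then have "integrable lebesgue (\<lambda>x. indicator (M \<inter> A) x *\<^sub>R v x)"
    using u vm unfolding set_integrable_def
    by (subst integrable_cong_AE[symmetric]) (auto intro: borel_measurable_integrable measurable_completion)
  then show ?thesis unfolding set_integrable_def using integrable_completion[OF vm] by simp
qed

text \<open>Averages ignore null sets, so outside \<open>M\<close> the two extensions agree at every
  point; inside \<open>M\<close> they inherit the almost everywhere equality.\<close>

lemma cell_extension_cong_AE:
  assumes M: "M \<in> sets borel"
    and u: "u \<in> borel_measurable (lebesgue_on M)" and v: "v \<in> borel_measurable (lebesgue_on M)"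
    and uv: "AE x in lborel. x \<in> M \<longrightarrow> u x = v x"
  shows "x \<notin> M \<Longrightarrow> cell_extension M s u x = cell_extension M s v x"
    and "AE x in lborel. cell_extension M s u x = cell_extension M s v x"
proof -
  show *: "cell_extension M s u x = cell_extension M s v x" if "x \<notin> M" for x
  proof -
    have "(LINT y:M \<inter> cell s x|lebesgue. u y) = (LINT y:M \<inter> cell s x|lebesgue. v y)"
      unfolding set_lebesgue_integral_def
    proof (rule integral_cong_AE)
      show "AE y in lebesgue. indicator (M \<inter> cell s x) y *\<^sub>R u y = indicator (M \<inter> cell s x) y *\<^sub>R v y"
        using AE_completion[OF uv] by eventually_elim auto
    qed (intro lebesgue_measurable_indicator_mult M u v borel_cell)+
    then show ?thesis using that by (simp add: cell_extension_def)
  qed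
  show "AE x in lborel. cell_extension M s u x = cell_extension M s v x"
    using uv
  proof eventually_elim
    case (elim x)
    then show ?case using *[of x] by (cases "x \<in> M") (simp_all add: cell_extension_def)
  qed
qed

section \<open>The cell extension as a continuous linear operator\<close>

context cell_filling
begin

lemma set_integrable_cell: "u \<in> Lp_set p (lebesgue_on M) \<Longrightarrow> set_integrable lebesgue (M \<inter> cell s x) u"
  by (rule Lp_set_set_integrable[OF p M _ borel_cell bounded_cell[OF s]])

lemma cell_extension_add:
  assumes "u \<in> Lp_set p (lebesgue_on M)" "v \<in> Lp_set p (lebesgue_on M)"
  shows "cell_extension M s (\<lambda>y. u y + v y) x = cell_extension M s u x + cell_extension M s v x"
  using set_integral_add(2)[OF set_integrable_cell[OF assms(1)] set_integrable_cell[OF assms(2)]]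
  by (simp add: cell_extension_def add_divide_distrib)

lemma cell_extension_diff:
  assumes "u \<in> Lp_set p (lebesgue_on M)" "v \<in> Lp_set p (lebesgue_on M)"
  shows "cell_extension M s (\<lambda>y. u y - v y) x = cell_extension M s u x - cell_extension M s v x"
  using set_integral_diff(2)[OF set_integrable_cell[OF assms(1)] set_integrable_cell[OF assms(2)]]
  by (simp add: cell_extension_def diff_divide_distrib)

lemma cell_extension_scale: "cell_extension M s (\<lambda>y. c * u y) x = c * cell_extension M s u x"
  by (simp add: cell_extension_def)

lemma cell_extension_representative:
  assumes u: "u \<in> Lp_set p (lebesgue_on M)"
  obtains v where "v \<in> borel_measurable borel" "AE x in lborel. x \<in> M \<longrightarrow> u x = v x"
    "AE x in lborel. cell_extension M s u x = cell_extension M s v x"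
    "cell_extension M s u \<in> borel_measurable lebesgue"
    "\<forall>A\<in>sets borel. bounded A \<longrightarrow> set_integrable lborel (M \<inter> A) v"
proof -
  have um: "u \<in> borel_measurable (lebesgue_on M)" using u by (simp add: Lp_set_def)
  obtain v where v: "v \<in> borel_measurable borel" "AE x in lborel. x \<in> M \<longrightarrow> u x = v x"
    using borel_representative[OF M um] by blast
  have vm: "v \<in> borel_measurable (lebesgue_on M)"
    using v(1) by (intro measurable_restrict_space1 measurable_completion) simp
  \<comment> \<open>Measurability follows by gluing \<open>u\<close> on \<open>M\<close> to the
    extension of \<open>v\<close> off \<open>M\<close>: this equals the extension of
    \<open>u\<close> at every point, not merely almost everywhere.\<close>
  have "(\<lambda>x. if x \<in> M then indicator (M \<inter> UNIV) x *\<^sub>R u x else cell_extension M s v x)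
      \<in> borel_measurable lebesgue"
  proof (rule measurable_If)
    show "(\<lambda>x. indicator (M \<inter> UNIV) x *\<^sub>R u x) \<in> borel_measurable lebesgue"
      by (rule lebesgue_measurable_indicator_mult[OF M um]) simp
    show "cell_extension M s v \<in> borel_measurable lebesgue"
      using borel_measurable_cell_extension[OF M v(1)] by (intro measurable_completion) simp
    show "{x \<in> space lebesgue. x \<in> M} \<in> sets lebesgue" using M by simp
  qed
  also have "(\<lambda>x. if x \<in> M then indicator (M \<inter> UNIV) x *\<^sub>R u x else cell_extension M s v x)
      = cell_extension M s u"
  proof
    fix x
    show "(if x \<in> M then indicator (M \<inter> UNIV) x *\<^sub>R u x else cell_extension M s v x) = cell_extension M s u x"
      using cell_extension_cong_AE(1)[OF M um vm v(2), of x s]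
      by (cases "x \<in> M") (simp_all add: cell_extension_def[of M s u])
  qed
  finally have "cell_extension M s u \<in> borel_measurable lebesgue" .
  moreover have "set_integrable lborel (M \<inter> A) v" if "A \<in> sets borel" "bounded A" for A
    using set_integrable_lborel_of_AE_eq[OF M that(1) v Lp_set_set_integrable[OF p M u that]] .
  ultimately show ?thesis using that v cell_extension_cong_AE(2)[OF M um vm v(2)] by blast
qed

text \<open>The weighted estimate for a Borel representative, with both weights one and
  \<open>c = 0\<close>.\<close>

lemma nn_integral_powr_cell_extension_le:
  assumes u: "u \<in> Lp_set p (lebesgue_on M)"
  shows "(\<integral>\<^sup>+x. ennreal (\<bar>cell_extension M s u x\<bar> powr p) \<partial>lebesgue)
    \<le> ennreal c1 * (\<integral>\<^sup>+x. ennreal (\<bar>u x\<bar> powr p) \<partial>lebesgue_on M)"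
proof -
  obtain v where v: "v \<in> borel_measurable borel" "AE x in lborel. x \<in> M \<longrightarrow> u x = v x"
    "AE x in lborel. cell_extension M s u x = cell_extension M s v x"
    "cell_extension M s u \<in> borel_measurable lebesgue"
    "\<forall>A\<in>sets borel. bounded A \<longrightarrow> set_integrable lborel (M \<inter> A) v"
    by (rule cell_extension_representative[OF u])
  have "(\<integral>\<^sup>+x. ennreal (\<bar>cell_extension M s u x\<bar> powr p) \<partial>lebesgue)
      = (\<integral>\<^sup>+x. 1 * ennreal (\<bar>cell_extension M s v x - 0\<bar> powr p) \<partial>lborel)"
    unfolding nn_integral_completion
    by (rule nn_integral_cong_AE, use v(3) in eventually_elim) simp
  also have "\<dots> \<le> ennreal c1 * (\<integral>\<^sup>+x. (if x \<in> M then 1 * ennreal (\<bar>v x - 0\<bar> powr p) else 0) \<partial>lborel)"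
    by (rule nn_integral_cell_extension_le) (simp_all add: v(1) v(5) borel_cell bounded_cell[OF s])
  finally show ?thesis by (simp add: nn_integral_lebesgue_on[OF M v(2)] cong: if_cong)
qed

lemma cell_extension_Lp_set:
  assumes u: "u \<in> Lp_set p (lebesgue_on M)"
  shows "cell_extension M s u \<in> Lp_set p lebesgue"
proof -
  have "cell_extension M s u \<in> borel_measurable lebesgue"
    by (rule cell_extension_representative[OF u])
  moreover have "(\<integral>\<^sup>+x. ennreal (\<bar>u x\<bar> powr p) \<partial>lebesgue_on M) < \<infinity>"
    using u Lp_set_iff_nn_integral[of u "lebesgue_on M" p] by (simp add: Lp_set_def)
  ultimately show ?thesis
    using nn_integral_powr_cell_extension_le[OF u]
    by (subst Lp_set_iff_nn_integral) (auto simp: ennreal_mult_less_top intro: le_less_trans)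
qed

lemma Lp_norm_cell_extension_le:
  assumes u: "u \<in> Lp_set p (lebesgue_on M)"
  shows "Lp_norm p lebesgue (cell_extension M s u) \<le> c1 powr (1 / p) * Lp_norm p (lebesgue_on M) u"
proof -
  define I where "I = (\<integral>x. \<bar>u x\<bar> powr p \<partial>lebesgue_on M)"
  have I: "I \<ge> 0" by (simp add: I_def)
  have "ennreal (\<integral>x. \<bar>cell_extension M s u x\<bar> powr p \<partial>lebesgue) \<le> ennreal c1 * ennreal I"
    using nn_integral_powr_cell_extension_le[OF u] cell_extension_Lp_set[OF u] u
    by (simp add: Lp_set_def nn_integral_eq_integral I_def)
  then have "(\<integral>x. \<bar>cell_extension M s u x\<bar> powr p \<partial>lebesgue) \<le> c1 * I"
    using c1 I by (simp add: ennreal_mult'[symmetric] ennreal_le_iff)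
  then have "Lp_norm p lebesgue (cell_extension M s u) \<le> (c1 * I) powr (1 / p)"
    unfolding Lp_norm_def using p by (intro powr_mono2) auto
  also have "\<dots> = c1 powr (1 / p) * Lp_norm p (lebesgue_on M) u"
    using c1 I by (simp add: Lp_norm_def I_def[symmetric] powr_mult)
  finally show ?thesis .
qed

text \<open>Additivity, differences and scaling hold pointwise, so continuity reduces to the norm
  bound for a difference, with \<open>\<delta> = \<epsilon> / K\<close>.\<close>

lemma continuous_linear_cell_extension: "continuous_linear_Lp p (lebesgue_on M) lebesgue (cell_extension M s)"
  unfolding continuous_linear_Lp_def
proof (intro conjI ballI allI impI)
  fix u v assume u: "u \<in> Lp_set p (lebesgue_on M)" and v: "v \<in> Lp_set p (lebesgue_on M)"
    and "AE x in lebesgue_on M. u x = v x"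
  then have "AE x in lborel. x \<in> M \<longrightarrow> u x = v x"
    using M by (simp add: AE_restrict_space_iff AE_completion_iff)
  then have "AE x in lborel. cell_extension M s u x = cell_extension M s v x"
    using u v by (intro cell_extension_cong_AE(2)[OF M]) (auto simp: Lp_set_def)
  then show "AE x in lebesgue. cell_extension M s u x = cell_extension M s v x"
    by (rule AE_completion)
next
  fix u and \<epsilon> :: real assume u: "u \<in> Lp_set p (lebesgue_on M)" and e: "0 < \<epsilon>"
  define K where "K = c1 powr (1 / p)"
  have K: "K > 0" using c1 by (simp add: K_def)
  show "\<exists>\<delta>>0. \<forall>v\<in>Lp_set p (lebesgue_on M). Lp_norm p (lebesgue_on M) (\<lambda>x. v x - u x) < \<delta> \<longrightarrow>
      Lp_norm p lebesgue (\<lambda>x. cell_extension M s v x - cell_extension M s u x) < \<epsilon>"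
  proof (intro exI conjI ballI impI)
    show "0 < \<epsilon> / K" using e K by simp
    fix v assume v: "v \<in> Lp_set p (lebesgue_on M)"
      and lt: "Lp_norm p (lebesgue_on M) (\<lambda>x. v x - u x) < \<epsilon> / K"
    have "Lp_norm p lebesgue (\<lambda>x. cell_extension M s v x - cell_extension M s u x)
        = Lp_norm p lebesgue (cell_extension M s (\<lambda>x. v x - u x))"
      by (simp add: cell_extension_diff[OF v u, abs_def])
    also have "\<dots> \<le> K * Lp_norm p (lebesgue_on M) (\<lambda>x. v x - u x)"
      unfolding K_def by (rule Lp_norm_cell_extension_le[OF Lp_set_diff[OF p v u]])
    also have "\<dots> < \<epsilon>" using lt K by (simp add: field_simps)
    finally show "Lp_norm p lebesgue (\<lambda>x. cell_extension M s v x - cell_extension M s u x) < \<epsilon>" .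
  qed
qed (simp_all add: cell_extension_Lp_set cell_extension_add cell_extension_scale)

end

section \<open>Choice of constants and proof of the extension theorem\<close>

text \<open>Each cell has the measures of a closed cube of half-side \<open>m + r0\<close>, whose
  filling ratio is at most the supremum \<open>const_c1 M m r0 - 1\<close>.\<close>

lemma cell_filling_const_c1:
  fixes M :: "(real ^ 'd) set"
  assumes "1 \<le> p" and M: "open M" and dens: "density_cond M r0 \<kappa>0" and path: "path_cond M r0 r1 m k Nmax"
  shows "cell_filling M p (m + r0) (const_c1 M m r0)"
proof -
  define s where "s = m + r0"
  have s: "0 < s" using dens path by (simp add: s_def density_cond_def path_cond_def)
  have Mb: "M \<in> sets borel" using M by simp
  have le: "fill_ratio M s c \<le> const_c1 M m r0 - 1" for c
    unfolding const_c1_def s_def using cSUP_upper[OF UNIV_I fill_ratio_bdd(2)[OF M dens path]] by simp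
  have pos: "measure lebesgue (M \<inter> cube c s) > 0" for c
    using fill_ratio_bdd(1)[OF M dens path] by (simp add: s_def)
  have "0 \<le> fill_ratio M s 0" by (simp add: fill_ratio_def)
  then have c1: "1 \<le> const_c1 M m r0" using le[of 0] by linarith
  show ?thesis unfolding s_def[symmetric]
  proof
    fix x
    obtain c where c: "measure lborel (M \<inter> cell s x) = measure lebesgue (M \<inter> cube c s)"
      "measure lborel (cell s x - M) = measure lebesgue (cube c s - M)"
      using cell_measure_eq_cube[OF s Mb] by blast
    show "0 < measure lborel (M \<inter> cell s x)" unfolding c by (rule pos)
    show "measure lborel (cell s x - M) \<le> (const_c1 M m r0 - 1) * measure lborel (M \<inter> cell s x)"
      using le[of c] pos[of c] unfolding c fill_ratio_def by (simp add: pos_divide_le_eq)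
  qed (use assms(1) s c1 Mb in auto)
qed

text \<open>The function \<open>c2\<close> is chosen before \<open>M\<close> and \<open>r1\<close>:
  besides its arguments it may depend only on \<open>p\<close>, \<open>r0\<close>,
  \<open>\<kappa>0\<close> and the dimension. Extended nonnegative integrals allow an infinite
  energy of \<open>u\<close>.\<close>

theorem lemmaA6:
  fixes p r0 \<kappa>0 :: real
  assumes "1 \<le> p" "0 < r0" "0 < \<kappa>0"
  shows "\<exists>c2 :: real \<Rightarrow> nat \<Rightarrow> nat \<Rightarrow> real \<Rightarrow> real \<Rightarrow> real.
    \<forall>(M :: (real ^ 'd) set) (r1 :: real) (m :: real) (k :: nat) (Nmax :: nat).
      open M \<longrightarrow> density_cond M r0 \<kappa>0 \<longrightarrow> path_cond M r0 r1 m k Nmax \<longrightarrow>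
      (\<exists>T :: (real ^ 'd \<Rightarrow> real) \<Rightarrow> (real ^ 'd \<Rightarrow> real).
         continuous_linear_Lp p (lebesgue_on M) lebesgue T \<and>
         (\<forall>r\<ge>2 * r0 + r1. \<forall>u\<in>Lp_set p (lebesgue_on M).
            (AE x in lebesgue_on M. T u x = u x) \<and>
            (\<integral>\<^sup>+x. ennreal (\<bar>T u x\<bar> powr p) \<partial>lebesgue)
              \<le> ennreal (const_c1 M m r0) * (\<integral>\<^sup>+x\<in>M. ennreal (\<bar>u x\<bar> powr p) \<partial>lebesgue) \<and>
            (\<integral>\<^sup>+z\<in>diag_nbhd (m + r0). ennreal (\<bar>T u (fst z) - T u (snd z)\<bar> powr p) \<partial>lebesgue)
              \<le> ennreal (c2 (const_c1 M m r0) k Nmax m r)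
                 * (\<integral>\<^sup>+z\<in>(M \<times> M) \<inter> diag_nbhd r. ennreal (\<bar>u (fst z) - u (snd z)\<bar> powr p) \<partial>lebesgue)))"
proof -
  define V where "V t = measure lborel (ball (0 :: real ^ 'd) t)" for t
  define b where "b = \<kappa>0 * V r0"
  have b: "b > 0" using assms content_ball_pos[of r0 "0 :: real ^ 'd"] by (simp add: b_def V_def)
  \<comment> \<open>\<open>L\<close> is the target range \<open>m + r0\<close> enlarged by two cell
    diameters; \<open>R\<close> adds room for the cubes of half-side \<open>k\<close> in which the
    paths run.\<close>
  define L where "L m = (m + r0) + 2 * (2 * (m + r0) * CARD('d))" for m
  define R where "R m k = L m + real k * CARD('d)" for m and k :: nat
  \<comment> \<open>A choice depending only on the parameters, since \<open>C\<close> has to be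
    fixed before \<open>M\<close>. Its covering property is available as soon as
    \<open>r - 2 * r0\<close> is positive, which \<open>r \<ge> 2 * r0 + r1\<close> ensures.\<close>
  define n where "n m k r = (SOME n. covering_bound TYPE(real ^ 'd) (R m k) (r - 2 * r0) n)" for m k r
  define C where "C m k r = 3 powr p * (2 * V (L m) / b
    + real (2 * (n m k r)\<^sup>2 + 1) powr p / b\<^sup>2 * V (R m k + r0) * V (L m))" for m k r
  show ?thesis
  proof (intro exI[of _ "\<lambda>c1 k Nmax m r. c1\<^sup>2 * C m k r"] allI impI)
    fix M :: "(real ^ 'd) set" and r1 m :: real and k Nmax :: nat
    assume opn: "open M" and dens: "density_cond M r0 \<kappa>0" and path: "path_cond M r0 r1 m k Nmax"
    define c1 where "c1 = const_c1 M m r0"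
    interpret cell_filling M p "m + r0" c1
      unfolding c1_def by (rule cell_filling_const_c1[OF assms(1) opn dens path])
    have r1: "r1 > 0" using path by (simp add: path_cond_def)
    have density: "b \<le> measure lborel (M \<inter> ball x r0)" if "x \<in> M" for x
    proof -
      have "\<kappa>0 \<le> measure lebesgue (M \<inter> ball x r0) / V r0"
        using dens that by (simp add: density_cond_def V_def)
      moreover have "V r0 > 0" using b assms by (simp add: b_def zero_less_mult_iff)
      moreover have "M \<inter> ball x r0 \<in> sets lborel" using M by simp
      ultimately show ?thesis by (simp add: b_def pos_le_divide_eq)
    qed
    show "\<exists>T :: (real ^ 'd \<Rightarrow> real) \<Rightarrow> (real ^ 'd \<Rightarrow> real).
         continuous_linear_Lp p (lebesgue_on M) lebesgue T \<and>
         (\<forall>r\<ge>2 * r0 + r1. \<forall>u\<in>Lp_set p (lebesgue_on M).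
            (AE x in lebesgue_on M. T u x = u x) \<and>
            (\<integral>\<^sup>+x. ennreal (\<bar>T u x\<bar> powr p) \<partial>lebesgue)
              \<le> ennreal (const_c1 M m r0) * (\<integral>\<^sup>+x\<in>M. ennreal (\<bar>u x\<bar> powr p) \<partial>lebesgue) \<and>
            (\<integral>\<^sup>+z\<in>diag_nbhd (m + r0). ennreal (\<bar>T u (fst z) - T u (snd z)\<bar> powr p) \<partial>lebesgue)
              \<le> ennreal ((const_c1 M m r0)\<^sup>2 * C m k r)
                 * (\<integral>\<^sup>+z\<in>(M \<times> M) \<inter> diag_nbhd r. ennreal (\<bar>u (fst z) - u (snd z)\<bar> powr p) \<partial>lebesgue))"
      unfolding c1_def[symmetric]
    proof (intro exI conjI allI impI ballI)
      show "continuous_linear_Lp p (lebesgue_on M) lebesgue (cell_extension M (m + r0))"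
        by (rule continuous_linear_cell_extension)
      fix r u assume r: "2 * r0 + r1 \<le> r" and u: "u \<in> Lp_set p (lebesgue_on M)"
      show "AE x in lebesgue_on M. cell_extension M (m + r0) u x = u x"
        by (rule AE_I2) (simp add: cell_extension_def space_restrict_space)
      have "(\<integral>\<^sup>+x. ennreal (\<bar>u x\<bar> powr p) \<partial>lebesgue_on M) = (\<integral>\<^sup>+x\<in>M. ennreal (\<bar>u x\<bar> powr p) \<partial>lebesgue)"
        using M by (intro nn_integral_restrict_space) simp
      then show "(\<integral>\<^sup>+x. ennreal (\<bar>cell_extension M (m + r0) u x\<bar> powr p) \<partial>lebesgue)
          \<le> ennreal c1 * (\<integral>\<^sup>+x\<in>M. ennreal (\<bar>u x\<bar> powr p) \<partial>lebesgue)"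
        using nn_integral_powr_cell_extension_le[OF u] by simp
      obtain v where v: "v \<in> borel_measurable borel" "AE x in lborel. x \<in> M \<longrightarrow> u x = v x"
        "AE x in lborel. cell_extension M (m + r0) u x = cell_extension M (m + r0) v x"
        "cell_extension M (m + r0) u \<in> borel_measurable lebesgue"
        "\<forall>A\<in>sets borel. bounded A \<longrightarrow> set_integrable lborel (M \<inter> A) v"
        by (rule cell_extension_representative[OF u])
      have n: "covering_bound TYPE(real ^ 'd) (R m k) (r - 2 * r0) (n m k r)"
        unfolding n_def by (rule someI_ex, rule covering_bound_exists) (use r r1 in simp)
      \<comment> \<open>The chain of estimates passes to the Borel representative \<open>v\<close>,
        bounds the energy of its extension by the energy on \<open>M\<close> at range
        \<open>L m\<close>, reduces the range to \<open>r\<close>, and returns to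
        \<open>u\<close>.\<close>
      have "(\<integral>\<^sup>+z\<in>diag_nbhd (m + r0). ennreal (\<bar>cell_extension M (m + r0) u (fst z)
            - cell_extension M (m + r0) u (snd z)\<bar> powr p) \<partial>lebesgue)
          = nonlocal_energy p UNIV (m + r0) (cell_extension M (m + r0) v)"
        using nn_integral_diag_nbhd[of UNIV "cell_extension M (m + r0) v" "cell_extension M (m + r0) u"]
          borel_measurable_cell_extension[OF M v(1)] v(3) by simp
      also have "\<dots> \<le> ennreal (c1\<^sup>2) * nonlocal_energy p M (L m) v"
        unfolding L_def by (rule nonlocal_energy_cell_extension_le[OF v(1)]) (simp add: v(5) borel_cell bounded_cell[OF s])
      also have "\<dots> \<le> ennreal (c1\<^sup>2) * (ennreal (C m k r) * nonlocal_energy p M r v)"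
      proof (rule mult_left_mono)
        show "nonlocal_energy p M (L m) v \<le> ennreal (C m k r) * nonlocal_energy p M r v"
          unfolding C_def V_def
        proof (rule nonlocal_energy_change_range[OF assms(1) _ v(1) _ density b assms(2) r1 r _ n])
          show "(x, y) \<in> (hops (M \<inter> ball x (R m k)) r1)\<^sup>*" if "x \<in> M" "y \<in> M" "dist x y < L m" for x y
            by (rule hops_of_path_cond[OF opn path that]) (simp add: R_def)
        qed (use M v(5) in \<open>auto simp: R_def\<close>)
      qed simp
      also have "\<dots> = ennreal (c1\<^sup>2 * C m k r)
          * (\<integral>\<^sup>+z\<in>(M \<times> M) \<inter> diag_nbhd r. ennreal (\<bar>u (fst z) - u (snd z)\<bar> powr p) \<partial>lebesgue)"
        using nn_integral_diag_nbhd[OF M v(1,2), of p r] by (simp add: ennreal_mult' mult.assoc)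
      finally show "(\<integral>\<^sup>+z\<in>diag_nbhd (m + r0). ennreal (\<bar>cell_extension M (m + r0) u (fst z)
            - cell_extension M (m + r0) u (snd z)\<bar> powr p) \<partial>lebesgue)
          \<le> ennreal (c1\<^sup>2 * C m k r)
          * (\<integral>\<^sup>+z\<in>(M \<times> M) \<inter> diag_nbhd r. ennreal (\<bar>u (fst z) - u (snd z)\<bar> powr p) \<partial>lebesgue)" .
    qed
  qed
qed

end
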